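(* Let $(M,g,K)$ be a three-dimensional vacuum initial data set which is asymptotically flat satisfying the Regge--Teitelboim condition (AF-RT), with ADM mass $m\neq 0$. Then the intrinsic center of mass and the Corvino--Schoen center of mass coincide: $$C_I^{\alpha}=C_{CS}^{\alpha},\qquad \alpha=1,2,3.$$
   Context: Repeated indices are summed. $M$ is a $3$-manifold, $g$ a Riemannian metric and $K$ a symmetric two-tensor on $M$. $(M,g,K)$ is a vacuum initial data set if $R_g-|K|_g^2+H^2=0$ and $\mathrm{div}_g(K)-dH=0$, where $R_g$ is the scalar curvature and $H=\mathrm{Tr}_g K=g^{ij}K_{ij}$. AF: a vacuum initial data set $(M,g,K)$ is asymptotically flat (AF) if there are coordinates $\{x\}$ on $M$ outside a compact set $B_{R_0}$ (identifying $M\setminus B_{R_0}$ with the exterior of a ball in $\mathbb{R}^3$) such that for some $\delta\in(1/2,1]$, $g_{ij}=\delta_{ij}+h_{ij}$ with $h_{ij}=O(|x|^{-\delta})$, $g_{ij,k}=O(|x|^{-1-\delta})$, $g_{ij,kl}=O(|x|^{-2-\delta})$, $K_{ij}=O(|x|^{-1-\delta})$, $K_{ij,k}=O(|x|^{-2-\delta})$, $K_{ij,kl}=O(|x|^{-3-\delta})$, and similarly for higher derivatives, up to third derivatives of $g$ and second derivatives of $K$. AF-RT: for a function $f$ on $M\setminus B_{R_0}$ put $f^{odd}(x)=f(x)-f(-x)$ and $f^{even}(x)=f(x)+f(-x)$. $(M,g,K)$ is AF-RT if it is AF and $g^{odd}_{ij}=O(|x|^{-1-\delta})$, $(g^{odd}_{ij})_{,k}=O(|x|^{-2-\delta})$,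 $K^{even}_{ij}=O(|x|^{-2-\delta})$, $(K^{even}_{ij})_{,k}=O(|x|^{-3-\delta})$, and correspondingly for higher derivatives (each further derivative gaining a factor $|x|^{-1}$). $\{|x|=r\}$ is the Euclidean coordinate sphere, $\nu_g$ its outward unit normal and $d\sigma_g$ its area form with respect to $g$. The ADM mass is $m=\frac{1}{16\pi}\lim_{r\to\infty}\int_{|x|=r}(g_{ij,i}-g_{ii,j})\nu_g^j\,d\sigma_g$. Intrinsic center of mass: with $R_{ij}$ the Ricci curvature of $g$ and $Y_{(\alpha)}=(|x|^2\delta^{\alpha i}-2x^\alpha x^i)\frac{\partial}{\partial x^i}$, $$C_I^\alpha=\frac{1}{16\pi m}\lim_{r\to\infty}\int_{|x|=r}\Big(R_{ij}-\tfrac12 R_g g_{ij}\Big)Y_{(\alpha)}^i\nu_g^j\,d\sigma_g .$$ Corvino--Schoen center of mass: $$C_{CS}^\alpha=\frac{1}{16\pi m}\lim_{r\to\infty}\left(\int_{|x|=r}x^\alpha(g_{ij,i}-g_{ii,j})\nu_g^j\,d\sigma_g-\int_{|x|=r}(h_{i\alpha}\nu_g^i-h_{ii}\nu_g^\alpha)\,d\sigma_g\right),$$ where $h_{ij}=g_{ij}-\delta_{ij}$. *)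

theory Defs
  imports "HOL-Analysis.Analysis" "HOL-Library.Landau_Symbols"
begin

section \<open>Partial derivatives\<close>

type_synonym R3 = "real^3"
type_synonym mat3 = "real^3^3"

definition pd :: "3 \<Rightarrow> (R3 \<Rightarrow> real) \<Rightarrow> R3 \<Rightarrow> real" where
  "pd i f x = frechet_derivative f (at x) (axis i 1)"

definition pds :: "3 list \<Rightarrow> (R3 \<Rightarrow> real) \<Rightarrow> R3 \<Rightarrow> real" where
  "pds ks f = foldr pd ks f"

text \<open>\<open>C_on k f S\<close>: \<open>f\<close> is of class \<open>C\<^sup>k\<close> on the open set \<open>S\<close>.\<close>

primrec C_on :: "nat \<Rightarrow> (R3 \<Rightarrow> real) \<Rightarrow> R3 set \<Rightarrow> bool" where
  "C_on 0 f S \<longleftrightarrow> continuous_on S f"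
| "C_on (Suc k) f S \<longleftrightarrow> (\<forall>x\<in>S. f differentiable (at x)) \<and> (\<forall>i. C_on k (pd i f) S)"

definition smooth_on :: "(R3 \<Rightarrow> real) \<Rightarrow> R3 set \<Rightarrow> bool" where
  "smooth_on f S \<longleftrightarrow> (\<forall>k. C_on k f S)"


section \<open>Smooth 3-manifolds and covariant two-tensors\<close>

text \<open>A chart is a pair of its domain and its coordinate map; the values of the
  map outside the domain are irrelevant.\<close>

type_synonym 'a chart = "'a set \<times> ('a \<Rightarrow> R3)"

abbreviation chart_image :: "'a chart \<Rightarrow> R3 set" where
  "chart_image c \<equiv> snd c ` fst c"

definition is_chart :: "'a topology \<Rightarrow> 'a chart \<Rightarrow> bool" where
  "is_chart M c \<longleftrightarrow> openin M (fst c) \<and> open (chart_image c) \<and>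
     homeomorphic_map (subtopology M (fst c)) (top_of_set (chart_image c)) (snd c)"

text \<open>The change of coordinates from \<open>c\<close> to \<open>d\<close>, meaningful on \<open>overlap c d\<close>.\<close>

definition transition :: "'a chart \<Rightarrow> 'a chart \<Rightarrow> R3 \<Rightarrow> R3" where
  "transition c d x = snd d (inv_into (fst c) (snd c) x)"

definition overlap :: "'a chart \<Rightarrow> 'a chart \<Rightarrow> R3 set" where
  "overlap c d = snd c ` (fst c \<inter> fst d)"

text \<open>The atlas is not required to be maximal, so the maximal one is a special case.\<close>

definition smooth_manifold3 :: "'a topology \<Rightarrow> 'a chart set \<Rightarrow> bool" where
  "smooth_manifold3 M A \<longleftrightarrow>
     Hausdorff_space M \<and> second_countable M \<and>
     (\<forall>c\<in>A. is_chart M c) \<and> (\<Union>c\<in>A. fst c) = topspace M \<and>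
     (\<forall>c\<in>A. \<forall>d\<in>A. \<forall>i. smooth_on (\<lambda>x. transition c d x $ i) (overlap c d))"

text \<open>A covariant two-tensor field is given by its component matrix in each chart of the
  atlas, as a function of the coordinates, subject to the usual transformation law.\<close>

type_synonym 'a tensor2 = "'a chart \<Rightarrow> R3 \<Rightarrow> mat3"

definition symmetric_tensor2 :: "nat \<Rightarrow> 'a chart set \<Rightarrow> 'a tensor2 \<Rightarrow> bool" where
  "symmetric_tensor2 k A T \<longleftrightarrow>
     (\<forall>c\<in>A. \<forall>i j. C_on k (\<lambda>x. T c x $ i $ j) (chart_image c)) \<and>
     (\<forall>c\<in>A. \<forall>x\<in>chart_image c. \<forall>i j. T c x $ i $ j = T c x $ j $ i) \<and>
     (\<forall>c\<in>A. \<forall>d\<in>A. \<forall>x\<in>overlap c d. \<forall>i j.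
        T c x $ i $ j = (\<Sum>k\<in>UNIV. \<Sum>l\<in>UNIV.
          pd i (\<lambda>y. transition c d y $ k) x * pd j (\<lambda>y. transition c d y $ l) x *
          T d (transition c d x) $ k $ l))"

definition riemannian_metric :: "nat \<Rightarrow> 'a chart set \<Rightarrow> 'a tensor2 \<Rightarrow> bool" where
  "riemannian_metric k A g \<longleftrightarrow> symmetric_tensor2 k A g \<and>
     (\<forall>c\<in>A. \<forall>x\<in>chart_image c. \<forall>v. v \<noteq> 0 \<longrightarrow> v \<bullet> (g c x *v v) > 0)"


section \<open>Curvature and constraint equations in coordinates\<close>

text \<open>In this section \<open>G\<close> and \<open>K\<close> are the component matrices of the metric and of the
  two-tensor in one coordinate system.\<close>

definition ginv :: "(R3 \<Rightarrow> mat3) \<Rightarrow> R3 \<Rightarrow> mat3" where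
  "ginv G x = matrix_inv (G x)"

definition christoffel :: "(R3 \<Rightarrow> mat3) \<Rightarrow> 3 \<Rightarrow> 3 \<Rightarrow> 3 \<Rightarrow> R3 \<Rightarrow> real" where
  "christoffel G k i j x = (1/2) * (\<Sum>l\<in>UNIV. ginv G x $ k $ l *
     (pd i (\<lambda>y. G y $ j $ l) x + pd j (\<lambda>y. G y $ i $ l) x - pd l (\<lambda>y. G y $ i $ j) x))"

definition ricci :: "(R3 \<Rightarrow> mat3) \<Rightarrow> 3 \<Rightarrow> 3 \<Rightarrow> R3 \<Rightarrow> real" where
  "ricci G i j x =
     (\<Sum>k\<in>UNIV. pd k (christoffel G k i j) x - pd j (christoffel G k i k) x) +
     (\<Sum>k\<in>UNIV. \<Sum>l\<in>UNIV. christoffel G k k l x * christoffel G l i j x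
                        - christoffel G k j l x * christoffel G l i k x)"

definition scalar_curvature :: "(R3 \<Rightarrow> mat3) \<Rightarrow> R3 \<Rightarrow> real" where
  "scalar_curvature G x = (\<Sum>i\<in>UNIV. \<Sum>j\<in>UNIV. ginv G x $ i $ j * ricci G i j x)"

definition tr_g :: "(R3 \<Rightarrow> mat3) \<Rightarrow> (R3 \<Rightarrow> mat3) \<Rightarrow> R3 \<Rightarrow> real" where
  "tr_g G K x = (\<Sum>i\<in>UNIV. \<Sum>j\<in>UNIV. ginv G x $ i $ j * K x $ i $ j)"

definition norm2_g :: "(R3 \<Rightarrow> mat3) \<Rightarrow> (R3 \<Rightarrow> mat3) \<Rightarrow> R3 \<Rightarrow> real" where
  "norm2_g G K x = (\<Sum>i\<in>UNIV. \<Sum>j\<in>UNIV. \<Sum>k\<in>UNIV. \<Sum>l\<in>UNIV.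
     ginv G x $ i $ k * ginv G x $ j $ l * K x $ i $ j * K x $ k $ l)"

text \<open>\<open>cov_deriv G K k i j\<close> is \<open>\<nabla>\<^sub>k K\<^sub>i\<^sub>j\<close>.\<close>

definition cov_deriv :: "(R3 \<Rightarrow> mat3) \<Rightarrow> (R3 \<Rightarrow> mat3) \<Rightarrow> 3 \<Rightarrow> 3 \<Rightarrow> 3 \<Rightarrow> R3 \<Rightarrow> real" where
  "cov_deriv G K k i j x = pd k (\<lambda>y. K y $ i $ j) x
     - (\<Sum>l\<in>UNIV. christoffel G l k i x * K x $ l $ j)
     - (\<Sum>l\<in>UNIV. christoffel G l k j x * K x $ i $ l)"

definition div_g :: "(R3 \<Rightarrow> mat3) \<Rightarrow> (R3 \<Rightarrow> mat3) \<Rightarrow> 3 \<Rightarrow> R3 \<Rightarrow> real" where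
  "div_g G K j x = (\<Sum>i\<in>UNIV. \<Sum>k\<in>UNIV. ginv G x $ i $ k * cov_deriv G K k i j x)"

text \<open>\<open>C\<^sup>3\<close> metrics and \<open>C\<^sup>2\<close> two-tensors: the regularity that the decay conditions below
  refer to. Smooth data are included.\<close>

definition vacuum_initial_data ::
  "'a topology \<Rightarrow> 'a chart set \<Rightarrow> 'a tensor2 \<Rightarrow> 'a tensor2 \<Rightarrow> bool" where
  "vacuum_initial_data M A g K \<longleftrightarrow>
     smooth_manifold3 M A \<and> riemannian_metric 3 A g \<and> symmetric_tensor2 2 A K \<and>
     (\<forall>c\<in>A. \<forall>x\<in>chart_image c.
        scalar_curvature (g c) x - norm2_g (g c) (K c) x + (tr_g (g c) (K c) x)\<^sup>2 = 0 \<and>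
        (\<forall>j. div_g (g c) (K c) j x - pd j (tr_g (g c) (K c)) x = 0))"


section \<open>Asymptotic flatness and the Regge--Teitelboim condition\<close>

text \<open>All partial derivatives of \<open>f\<close> up to order \<open>n\<close> decay, with
  \<open>\<partial>\<^sup>k f = O(|x|\<^sup>-\<^sup>p\<^sup>-\<^sup>k)\<close>.\<close>

definition decays :: "nat \<Rightarrow> real \<Rightarrow> (R3 \<Rightarrow> real) \<Rightarrow> bool" where
  "decays n p f \<longleftrightarrow> (\<forall>ks. length ks \<le> n \<longrightarrow>
     pds ks f \<in> O[at_infinity](\<lambda>x. norm x powr (- p - real (length ks))))"

definition end_chart :: "'a topology \<Rightarrow> 'a chart \<Rightarrow> bool" where
  "end_chart M c \<longleftrightarrow> (\<exists>B R\<^sub>0. compactin M B \<and> R\<^sub>0 > 0 \<and>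
     fst c = topspace M - B \<and> chart_image c = {x. norm x > R\<^sub>0})"

definition AF ::
  "real \<Rightarrow> 'a topology \<Rightarrow> 'a chart set \<Rightarrow> 'a tensor2 \<Rightarrow> 'a tensor2 \<Rightarrow> 'a chart \<Rightarrow> bool" where
  "AF \<delta> M A g K c \<longleftrightarrow> c \<in> A \<and> end_chart M c \<and> 1/2 < \<delta> \<and> \<delta> \<le> 1 \<and>
     (\<forall>i j. decays 3 \<delta> (\<lambda>x. g c x $ i $ j - mat 1 $ i $ j) \<and>
            decays 2 (1 + \<delta>) (\<lambda>x. K c x $ i $ j))"

definition AF_RT ::
  "'a topology \<Rightarrow> 'a chart set \<Rightarrow> 'a tensor2 \<Rightarrow> 'a tensor2 \<Rightarrow> 'a chart \<Rightarrow> bool" where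
  "AF_RT M A g K c \<longleftrightarrow> (\<exists>\<delta>. AF \<delta> M A g K c \<and>
     (\<forall>i j. decays 3 (1 + \<delta>) (\<lambda>x. g c x $ i $ j - g c (- x) $ i $ j) \<and>
            decays 2 (2 + \<delta>) (\<lambda>x. K c x $ i $ j + K c (- x) $ i $ j)))"


section \<open>Integration over coordinate spheres\<close>

definition sphere_param :: "real \<Rightarrow> real \<Rightarrow> real \<Rightarrow> R3" where
  "sphere_param r \<theta> \<phi> =
     vector [r * sin \<theta> * cos \<phi>, r * sin \<theta> * sin \<phi>, r * cos \<theta>]"

definition area_density :: "(R3 \<Rightarrow> mat3) \<Rightarrow> real \<Rightarrow> real \<Rightarrow> real \<Rightarrow> real" where
  "area_density G r \<theta> \<phi> =
     (let x = sphere_param r \<theta> \<phi>;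
          u = vector_derivative (\<lambda>t. sphere_param r t \<phi>) (at \<theta>);
          v = vector_derivative (\<lambda>t. sphere_param r \<theta> t) (at \<phi>)
      in sqrt ((u \<bullet> (G x *v u)) * (v \<bullet> (G x *v v)) - (u \<bullet> (G x *v v))\<^sup>2))"

text \<open>\<open>sphere_integral G r f\<close> is the integral of \<open>f\<close> over \<open>{|x| = r}\<close> with respect to the
  area form induced by \<open>G\<close>.\<close>

definition sphere_integral :: "(R3 \<Rightarrow> mat3) \<Rightarrow> real \<Rightarrow> (R3 \<Rightarrow> real) \<Rightarrow> real" where
  "sphere_integral G r f =
     integral ({0..pi} \<times> {0..2*pi}) (\<lambda>(\<theta>, \<phi>). f (sphere_param r \<theta> \<phi>) * area_density G r \<theta> \<phi>)"

text \<open>The normalised gradient of \<open>|x|\<close>; lemma \<open>unit_normal_iff\<close> identifies it as the outward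
  unit normal of the coordinate sphere through \<open>x\<close>.\<close>

definition unit_normal :: "(R3 \<Rightarrow> mat3) \<Rightarrow> R3 \<Rightarrow> R3" where
  "unit_normal G x = (1 / sqrt (x \<bullet> (ginv G x *v x))) *\<^sub>R (ginv G x *v x)"

lemma unit_normal_iff:
  assumes sym: "\<And>i j. G x $ i $ j = G x $ j $ i"
    and pos: "\<And>v. v \<noteq> 0 \<Longrightarrow> v \<bullet> (G x *v v) > 0"
    and "x \<noteq> 0"
  shows "n = unit_normal G x \<longleftrightarrow>
    n \<bullet> (G x *v n) = 1 \<and> (\<forall>w. x \<bullet> w = 0 \<longrightarrow> n \<bullet> (G x *v w) = 0) \<and> x \<bullet> n > 0"
proof -
  define N where "N = ginv G x"
  have trG: "transpose (G x) = G x"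
    by (simp add: transpose_def vec_eq_iff sym)
  have symG: "a \<bullet> (G x *v b) = (G x *v a) \<bullet> b" for a b
    using dot_lmul_matrix[of a "G x" b] trG by (metis transpose_matrix_vector)
  have "inj ((*v) (G x))"
  proof (rule injI)
    fix a b assume "G x *v a = G x *v b"
    then have "(a - b) \<bullet> (G x *v (a - b)) = 0"
      by (simp add: matrix_vector_mult_diff_distrib)
    then show "a = b" using pos[of "a - b"] by force
  qed
  then have "invertible (G x)"
    by (simp add: invertible_left_inverse matrix_left_invertible_injective)
  then have "G x ** N = mat 1" "N ** G x = mat 1"
    unfolding N_def ginv_def matrix_inv_def invertible_def
    by (metis (mono_tags, lifting) someI_ex)+
  then have GN: "G x *v (N *v a) = a" and NG: "N *v (G x *v a) = a" for a
    by (simp_all add: matrix_vector_mul_assoc)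
  define y where "y = N *v x"
  have Gy: "G x *v y = x" by (simp add: y_def GN)
  have "y \<noteq> 0" using Gy \<open>x \<noteq> 0\<close> by auto
  then have s: "x \<bullet> y > 0" using pos[of y] Gy by (simp add: inner_commute)
  define s where "s = sqrt (x \<bullet> y)"
  have s0: "s > 0" and s2: "s * s = x \<bullet> y" using s by (auto simp: s_def)
  have nu: "unit_normal G x = (1 / s) *\<^sub>R y"
    by (simp add: unit_normal_def s_def y_def N_def)
  show ?thesis
  proof
    assume n: "n = unit_normal G x"
    then have "n = (1 / s) *\<^sub>R y" by (simp add: nu)
    then have Gn: "G x *v n = (1 / s) *\<^sub>R x"
      by (simp add: matrix_vector_mult_scaleR Gy)
    show "n \<bullet> (G x *v n) = 1 \<and> (\<forall>w. x \<bullet> w = 0 \<longrightarrow> n \<bullet> (G x *v w) = 0) \<and> x \<bullet> n > 0"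
      using s0 s2 s by (auto simp: symG Gn \<open>n = (1 / s) *\<^sub>R y\<close> Gy
          matrix_vector_mult_scaleR inner_commute field_simps)
  next
    assume R: "n \<bullet> (G x *v n) = 1 \<and> (\<forall>w. x \<bullet> w = 0 \<longrightarrow> n \<bullet> (G x *v w) = 0) \<and> x \<bullet> n > 0"
    define a where "a = (x \<bullet> (G x *v n)) / (x \<bullet> x)"
    define w where "w = G x *v n - a *\<^sub>R x"
    have xw: "x \<bullet> w = 0" using \<open>x \<noteq> 0\<close> by (simp add: w_def a_def inner_diff_right)
    then have "(G x *v n) \<bullet> w = 0" using R symG by metis
    then have "w \<bullet> w = 0" using xw by (simp add: w_def inner_diff_left)
    then have "G x *v n = a *\<^sub>R x" by (simp add: w_def)
    then have na: "n = a *\<^sub>R y"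
      by (metis NG matrix_vector_mult_scaleR y_def)
    have "a > 0" using R s by (simp add: na zero_less_mult_iff)
    moreover have "a * a * (s * s) = 1"
      using R by (simp add: na matrix_vector_mult_scaleR Gy s2 inner_commute)
    ultimately have "(a * s)\<^sup>2 = 1\<^sup>2" "a * s > 0"
      using s0 by (simp_all add: power2_eq_square algebra_simps)
    then have "a * s = 1" by (metis less_imp_le power2_eq_imp_eq zero_le_one)
    then have "a = 1 / s" using s0 by (simp add: field_simps)
    then show "n = unit_normal G x" by (simp add: na nu)
  qed
qed


section \<open>ADM mass and centers of mass\<close>

definition adm_mass :: "(R3 \<Rightarrow> mat3) \<Rightarrow> real" where
  "adm_mass G = 1 / (16 * pi) * Lim at_top (\<lambda>r. sphere_integral G r
     (\<lambda>x. \<Sum>i\<in>UNIV. \<Sum>j\<in>UNIV.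
        (pd i (\<lambda>y. G y $ i $ j) x - pd j (\<lambda>y. G y $ i $ i) x) * unit_normal G x $ j))"

definition Y_field :: "3 \<Rightarrow> R3 \<Rightarrow> R3" where
  "Y_field \<alpha> x = (norm x)\<^sup>2 *\<^sub>R axis \<alpha> 1 - (2 * x $ \<alpha>) *\<^sub>R x"

definition intrinsic_flux :: "(R3 \<Rightarrow> mat3) \<Rightarrow> 3 \<Rightarrow> real \<Rightarrow> real" where
  "intrinsic_flux G \<alpha> r = sphere_integral G r
     (\<lambda>x. \<Sum>i\<in>UNIV. \<Sum>j\<in>UNIV.
        (ricci G i j x - 1/2 * scalar_curvature G x * G x $ i $ j) *
        Y_field \<alpha> x $ i * unit_normal G x $ j)"

definition intrinsic_center :: "(R3 \<Rightarrow> mat3) \<Rightarrow> 3 \<Rightarrow> real" where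
  "intrinsic_center G \<alpha> = 1 / (16 * pi * adm_mass G) * Lim at_top (intrinsic_flux G \<alpha>)"

definition corvino_schoen_flux :: "(R3 \<Rightarrow> mat3) \<Rightarrow> 3 \<Rightarrow> real \<Rightarrow> real" where
  "corvino_schoen_flux G \<alpha> r =
     sphere_integral G r
       (\<lambda>x. \<Sum>i\<in>UNIV. \<Sum>j\<in>UNIV. x $ \<alpha> *
          (pd i (\<lambda>y. G y $ i $ j) x - pd j (\<lambda>y. G y $ i $ i) x) * unit_normal G x $ j)
     - sphere_integral G r
       (\<lambda>x. let h = G x - mat 1; \<nu> = unit_normal G x
            in \<Sum>i\<in>UNIV. h $ i $ \<alpha> * \<nu> $ i - h $ i $ i * \<nu> $ \<alpha>)"

definition corvino_schoen_center :: "(R3 \<Rightarrow> mat3) \<Rightarrow> 3 \<Rightarrow> real" where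
  "corvino_schoen_center G \<alpha> =
     1 / (16 * pi * adm_mass G) * Lim at_top (corvino_schoen_flux G \<alpha>)"

end

theory Submission
  imports Defs
begin

text \<open>
  Write \<open>g = \<delta> + h\<close> in the asymptotic chart. Both fluxes are, to leading order, integrals over the
  round sphere of densities that are linear in \<open>h\<close>, and the proof compares these linear parts exactly
  and estimates the rest.

  \<^emph>\<open>Parity beats power counting.\<close> The linear parts of the densities decay like \<open>|x|\<^sup>-\<^sup>\<delta>\<close>
  and the quadratic errors like \<open>|x|\<^sup>-\<^sup>2\<^sup>\<delta>\<close>; since the area of the sphere grows like \<open>r\<^sup>2\<close>, neither is
  negligible by its size alone. But the sphere is invariant under \<open>x \<mapsto> -x\<close>: a density that is odd up to a relative error \<open>1/|x|\<close> loses one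
  more power when it is integrated (\<open>round_integral_odd_bigo\<close>). The Regge--Teitelboim condition
  makes \<open>h\<close> asymptotically even, every derivative flips the parity, and the result is that all
  quadratic errors of both densities are asymptotically odd. They contribute \<open>O(r\<^sup>1\<^sup>-\<^sup>2\<^sup>\<delta>)\<close>, which
  vanishes in the limit because \<open>\<delta> > 1/2\<close>. The class \<open>parity_decay\<close> records decay and parity
  together; it is closed under sums and products, and the errors from the curvature
  (\<open>ricci_linear\<close>, \<open>scalar_linear\<close>) and from the area form and the unit normal
  (\<open>sphere_integral_flux\<close>) are read off from the formulas.

  \<^emph>\<open>The linear fluxes agree on every sphere.\<close> The field \<open>Y\<close> is conformal Killing, with
  \<open>\<partial>\<^sub>i Y\<^sub>j + \<partial>\<^sub>j Y\<^sub>i = - 4 x\<^sup>\<alpha> \<delta>\<^sub>i\<^sub>j\<close>, and the linearized Einstein tensor is divergence free, so its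
  contraction with \<open>Y\<close> has divergence \<open>x\<^sup>\<alpha>\<close> times the linearized scalar curvature. The
  Corvino--Schoen density is the normal component of a vector field with the same divergence. The
  difference of the two fields is therefore divergence free, and in fact it is the divergence of an
  explicit antisymmetric matrix field (\<open>einstein_minus_cs\<close>); such a field has no flux through a
  closed surface (\<open>round_flux_antisymmetric_divergence\<close>).

  \<^emph>\<open>The limit exists.\<close> The radial derivative of the common linear flux is the integral of \<open>x\<^sup>\<alpha>\<close> times
  the linearized scalar curvature. By the Hamiltonian constraint the scalar curvature is quadratic
  in \<open>K\<close>, hence \<open>O(|x|\<^sup>-\<^sup>2\<^sup>-\<^sup>2\<^sup>\<delta>)\<close> and asymptotically even, so the derivative is \<open>O(r\<^sup>-\<^sup>2\<^sup>\<delta>)\<close>,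
  which is integrable at infinity (\<open>center_fluxes_converge\<close>).
\<close>

section \<open>Partial derivatives\<close>

lemma has_derivative_pd:
  assumes "f differentiable (at x)"
  shows "(f has_derivative (\<lambda>v. \<Sum>i\<in>UNIV. v $ i * pd i f x)) (at x)"
proof -
  let ?D = "frechet_derivative f (at x)"
  have D: "(f has_derivative ?D) (at x)"
    using assms frechet_derivative_works by blast
  then interpret bounded_linear ?D
    by (rule has_derivative_bounded_linear)
  have "?D v = (\<Sum>i\<in>UNIV. v $ i * pd i f x)" for v
  proof -
    have "?D v = ?D (\<Sum>i\<in>UNIV. v $ i *\<^sub>R axis i 1)"
      using basis_expansion[of v] by (simp add: scalar_mult_eq_scaleR)
    then show ?thesis
      by (simp add: sum scaleR pd_def)
  qed
  then have "?D = (\<lambda>v. \<Sum>i\<in>UNIV. v $ i * pd i f x)" by (rule ext)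
  with D show ?thesis by simp
qed

lemma pd_eqI:
  assumes "(f has_derivative f') (at x)"
  shows "pd i f x = f' (axis i 1)"
  using frechet_derivative_at[OF assms] by (simp add: pd_def)

lemma pd_cong:
  assumes "open S" "x \<in> S" "\<And>y. y \<in> S \<Longrightarrow> f y = g y"
  shows "pd i f x = pd i g x"
proof -
  have "(f has_derivative f') (at x) \<longleftrightarrow> (g has_derivative f') (at x)" for f'
    using has_derivative_transform_within_open[of f f' x UNIV S g]
      has_derivative_transform_within_open[of g f' x UNIV S f] assms by metis
  then show ?thesis
    by (simp add: pd_def frechet_derivative_def)
qed

lemma differentiable_cong_open:
  assumes "open S" "x \<in> S" "\<And>y. y \<in> S \<Longrightarrow> f y = g y" "f differentiable (at x)"
  shows "g differentiable (at x)"
  using assms unfolding differentiable_def by (blast intro: has_derivative_transform_within_open)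

lemma pd_const: "pd i (\<lambda>x. a) x = 0"
  by (subst pd_eqI[of _ "\<lambda>_. 0"]) auto

lemma pd_coord: "pd i (\<lambda>x. x $ j) x = (if i = j then 1 else 0)"
  by (subst pd_eqI[of _ "\<lambda>x. x $ j"]) 
     (auto intro!: bounded_linear_imp_has_derivative bounded_linear_vec_nth simp: axis_def)

lemma pd_add:
  assumes "f differentiable (at x)" "g differentiable (at x)"
  shows "pd i (\<lambda>x. f x + g x) x = pd i f x + pd i g x"
  by (subst pd_eqI[OF has_derivative_add[OF assms[unfolded frechet_derivative_works]]])
     (simp add: pd_def)

lemma pd_diff:
  assumes "f differentiable (at x)" "g differentiable (at x)"
  shows "pd i (\<lambda>x. f x - g x) x = pd i f x - pd i g x"
  by (subst pd_eqI[OF has_derivative_diff[OF assms[unfolded frechet_derivative_works]]])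
     (simp add: pd_def)

lemma pd_mult:
  assumes "f differentiable (at x)" "g differentiable (at x)"
  shows "pd i (\<lambda>x. f x * g x) x = pd i f x * g x + f x * pd i g x"
  by (subst pd_eqI[OF has_derivative_mult[OF assms[unfolded frechet_derivative_works]]])
     (simp add: pd_def)

lemma pd_cmult:
  assumes "f differentiable (at x)"
  shows "pd i (\<lambda>x. a * f x) x = a * pd i f x"
  using pd_mult[of "\<lambda>_. a" x f i] assms by (simp add: pd_const)

lemma pd_sum:
  assumes "\<And>k. k \<in> I \<Longrightarrow> f k differentiable (at x)"
  shows "pd i (\<lambda>x. \<Sum>k\<in>I. f k x) x = (\<Sum>k\<in>I. pd i (f k) x)"
  by (subst pd_eqI[OF has_derivative_sum[of I f "\<lambda>k. frechet_derivative (f k) (at x)"]])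
     (use assms in \<open>auto simp: pd_def frechet_derivative_works[symmetric]\<close>)

lemma pd_inverse:
  assumes "f differentiable (at x)" "f x \<noteq> 0"
  shows "pd i (\<lambda>x. inverse (f x)) x = - (inverse (f x) * pd i f x * inverse (f x))"
  by (subst pd_eqI[OF Deriv.has_derivative_inverse[OF assms(2)
        assms(1)[unfolded frechet_derivative_works]]]) (simp add: pd_def)

lemma has_derivative_compose_uminus:
  fixes f :: "R3 \<Rightarrow> real"
  assumes "f differentiable (at (- x))"
  shows "((\<lambda>y. f (- y)) has_derivative (\<lambda>v. frechet_derivative f (at (- x)) (- v))) (at x)"
  using assms[unfolded frechet_derivative_works]
  by (intro has_derivative_compose[where f = uminus and g = f]) (auto intro!: derivative_eq_intros)

lemma pd_compose_uminus:
  assumes "f differentiable (at (- x))"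
  shows "pd i (\<lambda>y. f (- y)) x = - pd i f (- x)"
proof -
  have "linear (frechet_derivative f (at (- x)))"
    using assms frechet_derivative_works linear_frechet_derivative by blast
  then show ?thesis
    by (subst pd_eqI[OF has_derivative_compose_uminus[OF assms]])
       (simp add: pd_def linear_neg)
qed

lemma has_vector_derivative_along:
  assumes p: "(p has_vector_derivative p') (at t within T)" and f: "f differentiable (at (p t))"
  shows "((\<lambda>t. f (p t)) has_vector_derivative (\<Sum>i\<in>UNIV. p' $ i * pd i f (p t))) (at t within T)"
proof -
  have "((\<lambda>t. f (p t)) has_derivative
      (\<lambda>s. \<Sum>i\<in>UNIV. (s *\<^sub>R p') $ i * pd i f (p t))) (at t within T)"
    using p by (intro has_derivative_compose[where f = p and g = f, OF _ has_derivative_pd[OF f]])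
      (simp add: has_vector_derivative_def)
  then show ?thesis
    by (simp add: has_vector_derivative_def sum_distrib_left mult.assoc)
qed

lemma C_on_1:
  "C_on 1 f S \<longleftrightarrow> (\<forall>x\<in>S. f differentiable (at x)) \<and> (\<forall>i. continuous_on S (pd i f))"
  unfolding One_nat_def C_on.simps ..

lemma C_on_continuous: "C_on k f S \<Longrightarrow> continuous_on S f"
  by (cases k) (auto intro!: continuous_at_imp_continuous_on differentiable_imp_continuous_within)

lemma C_on_mono: "C_on k f S \<Longrightarrow> l \<le> k \<Longrightarrow> C_on l f S"
proof (induction k arbitrary: f l)
  case (Suc k)
  show ?case
  proof (cases l)
    case 0
    then show ?thesis using C_on_continuous[OF Suc.prems(1)] by simp
  next
    case (Suc l')
    then show ?thesis using Suc.IH Suc.prems by auto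
  qed
qed simp

lemma C_on_cong_open:
  assumes "open S" "\<And>x. x \<in> S \<Longrightarrow> f x = g x" "C_on k f S"
  shows "C_on k g S"
  using assms(2,3)
proof (induction k arbitrary: f g)
  case 0
  then show ?case
    by (auto elim: continuous_on_eq)
next
  case (Suc k)
  have "C_on k (pd i g) S" for i
    by (rule Suc.IH[of "pd i f"]) (use Suc.prems in \<open>auto intro: pd_cong[OF \<open>open S\<close>]\<close>)
  moreover have "g differentiable (at x)" if "x \<in> S" for x
    using that Suc.prems by (intro differentiable_cong_open[OF \<open>open S\<close> that Suc.prems(1)]) auto
  ultimately show ?case
    by simp
qed

lemma C_on_diff_const:
  assumes "open S" "C_on k f S"
  shows "C_on k (\<lambda>x. f x - a) S"
proof (cases k)
  case 0
  then show ?thesis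
    using assms by (auto intro: continuous_on_diff)
next
  case (Suc l)
  have "C_on l (pd i (\<lambda>x. f x - a)) S" for i
    by (rule C_on_cong_open[OF \<open>open S\<close>, of "pd i f"])
       (use assms Suc in \<open>auto simp: pd_diff pd_const\<close>)
  with assms Suc show ?thesis
    by (auto intro: differentiable_diff)
qed

lemma C_on_pd: "C_on (Suc k) f S \<Longrightarrow> C_on k (pd i f) S"
  by simp

lemma C1_const: "C_on 1 (\<lambda>x. a) S"
  by (auto simp: C_on_1 pd_const)

lemma C1_coord: "C_on 1 (\<lambda>x. x $ j) S"
  by (auto simp: C_on_1 pd_coord
      intro!: bounded_linear_imp_differentiable bounded_linear_vec_nth)

lemma C1_add:
  assumes "C_on 1 f S" "C_on 1 g S"
  shows "C_on 1 (\<lambda>x. f x + g x) S"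
proof -
  have "continuous_on S (pd i (\<lambda>x. f x + g x))" for i
    using assms unfolding C_on_1
    by (subst continuous_on_cong[OF refl pd_add]) (auto intro: continuous_on_add)
  with assms show ?thesis
    by (auto simp: C_on_1 intro: differentiable_add)
qed

lemma C1_diff:
  assumes "C_on 1 f S" "C_on 1 g S"
  shows "C_on 1 (\<lambda>x. f x - g x) S"
proof -
  have "continuous_on S (pd i (\<lambda>x. f x - g x))" for i
    using assms unfolding C_on_1
    by (subst continuous_on_cong[OF refl pd_diff]) (auto intro: continuous_on_diff)
  with assms show ?thesis
    by (auto simp: C_on_1 intro: differentiable_diff)
qed

lemma C1_mult:
  assumes "C_on 1 f S" "C_on 1 g S"
  shows "C_on 1 (\<lambda>x. f x * g x) S"
proof -
  have "continuous_on S f" "continuous_on S g"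
    using assms C_on_continuous by blast+
  then have "continuous_on S (pd i (\<lambda>x. f x * g x))" for i
    using assms unfolding C_on_1
    by (subst continuous_on_cong[OF refl pd_mult]) (auto intro!: continuous_intros)
  with assms show ?thesis
    by (auto simp: C_on_1 intro: differentiable_mult)
qed

lemma C1_sum:
  assumes "\<And>k. k \<in> I \<Longrightarrow> C_on 1 (f k) S"
  shows "C_on 1 (\<lambda>x. \<Sum>k\<in>I. f k x) S"
  using assms
  by (induction I rule: infinite_finite_induct) (auto intro!: C1_const C1_add simp del: One_nat_def)

lemmas C1_intros = C1_const C1_coord C1_add C1_diff C1_mult C1_sum

lemma C1_differentiable: "C_on 1 f S \<Longrightarrow> x \<in> S \<Longrightarrow> f differentiable (at x)"
  by (simp add: C_on_1)

text \<open>
  Applying the mean value theorem first along \<open>i\<close> and then along \<open>j\<close> expresses the second difference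
  over a small square as a mixed derivative. The difference itself is symmetric in \<open>i\<close> and \<open>j\<close>, which
  is what makes the mixed derivatives commute.
\<close>

lemma second_difference_mean_value:
  assumes S: "open S" and f: "C_on 2 f S" and x: "cball x (2 * t) \<subseteq> S" and t: "t > 0"
  shows "\<exists>y\<in>cball x (2 * t). f (x + t *\<^sub>R axis i 1 + t *\<^sub>R axis j 1) - f (x + t *\<^sub>R axis i 1)
      - f (x + t *\<^sub>R axis j 1) + f x = t\<^sup>2 * pd j (pd i f) y"
proof -
  let ?e = "\<lambda>i. axis i (1::real) :: R3"
  have near: "x + s *\<^sub>R ?e i + u *\<^sub>R ?e j \<in> cball x (2 * t)"
    if "0 \<le> s" "s \<le> t" "0 \<le> u" "u \<le> t" for s u
  proof -
    have "norm (s *\<^sub>R ?e i + u *\<^sub>R ?e j) \<le> s + u"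
      using norm_triangle_ineq[of "s *\<^sub>R ?e i" "u *\<^sub>R ?e j"] that by simp
    then show ?thesis
      using that norm_minus_cancel[of "s *\<^sub>R ?e i + u *\<^sub>R ?e j"]
      by (simp add: dist_norm add.assoc del: norm_minus_cancel)
  qed
  have f2: "C_on 1 f S" "C_on 1 (pd i f) S"
    using f C_on_mono[of 2 f S 1] C_on_pd[of 1 f S i] by (simp_all add: numeral_2_eq_2)
  have along: "((\<lambda>s. g (p s)) has_real_derivative pd k g (p s)) (at s)"
    if "(p has_vector_derivative ?e k) (at s)" "C_on 1 g S" "p s \<in> S" for g p s k
  proof -
    have "(\<Sum>l\<in>UNIV. ?e k $ l * pd l g (p s)) = pd k g (p s)"
      by (simp add: axis_def if_distrib[of "\<lambda>a. a * _"] cong: if_cong)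
    then show ?thesis
      using has_vector_derivative_along[OF that(1), of g] C1_differentiable[OF that(2,3)]
      by (simp add: has_real_derivative_iff_has_vector_derivative)
  qed
  have along_i: "((\<lambda>s. g (x + s *\<^sub>R ?e i + u *\<^sub>R ?e j)) has_real_derivative
      pd i g (x + s *\<^sub>R ?e i + u *\<^sub>R ?e j)) (at s)"
    and along_j: "((\<lambda>u. g (x + s *\<^sub>R ?e i + u *\<^sub>R ?e j)) has_real_derivative
      pd j g (x + s *\<^sub>R ?e i + u *\<^sub>R ?e j)) (at u)"
    if "0 \<le> s" "s \<le> t" "0 \<le> u" "u \<le> t" "C_on 1 g S" for g s u
    using near[OF that(1-4)] x
    by (auto intro!: along that(5) derivative_eq_intros)
  let ?\<phi> = "\<lambda>s. f (x + s *\<^sub>R ?e i + t *\<^sub>R ?e j) - f (x + s *\<^sub>R ?e i + 0 *\<^sub>R ?e j)"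
  obtain s where s: "0 < s" "s < t" "?\<phi> t - ?\<phi> 0 = (t - 0) *
      (pd i f (x + s *\<^sub>R ?e i + t *\<^sub>R ?e j) - pd i f (x + s *\<^sub>R ?e i + 0 *\<^sub>R ?e j))"
    using MVT2[OF t, of ?\<phi> "\<lambda>s. pd i f (x + s *\<^sub>R ?e i + t *\<^sub>R ?e j)
        - pd i f (x + s *\<^sub>R ?e i + 0 *\<^sub>R ?e j)", OF DERIV_diff[OF along_i along_i]] t f2 by auto
  obtain u where u: "0 < u" "u < t"
    "pd i f (x + s *\<^sub>R ?e i + t *\<^sub>R ?e j) - pd i f (x + s *\<^sub>R ?e i + 0 *\<^sub>R ?e j)
      = (t - 0) * pd j (pd i f) (x + s *\<^sub>R ?e i + u *\<^sub>R ?e j)"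
    using MVT2[OF t, of "\<lambda>u. pd i f (x + s *\<^sub>R ?e i + u *\<^sub>R ?e j)"
        "\<lambda>u. pd j (pd i f) (x + s *\<^sub>R ?e i + u *\<^sub>R ?e j)", OF along_j] s t f2 by auto
  show ?thesis
    using near[of s u] s u by (intro bexI[of _ "x + s *\<^sub>R ?e i + u *\<^sub>R ?e j"])
      (auto simp: power2_eq_square)
qed

lemma pd_pd_commute:
  assumes S: "open S" and f: "C_on 2 f S" and x: "x \<in> S"
  shows "pd i (pd j f) x = pd j (pd i f) x"
proof (rule ccontr)
  let ?a = "pd i (pd j f)" and ?b = "pd j (pd i f)"
  assume "?a x \<noteq> ?b x"
  define \<epsilon> where "\<epsilon> = \<bar>?a x - ?b x\<bar> / 2"
  have "\<epsilon> > 0" using \<open>?a x \<noteq> ?b x\<close> by (simp add: \<epsilon>_def)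
  have "continuous_on S ?a" "continuous_on S ?b"
    using f by (auto simp: numeral_2_eq_2)
  then have "isCont ?a x" "isCont ?b x"
    using S x by (auto simp: continuous_on_eq_continuous_at)
  then obtain d1 d2 where d: "d1 > 0" "\<And>y. dist y x < d1 \<Longrightarrow> dist (?a y) (?a x) < \<epsilon>"
    "d2 > 0" "\<And>y. dist y x < d2 \<Longrightarrow> dist (?b y) (?b x) < \<epsilon>"
    unfolding continuous_at_eps_delta using \<open>\<epsilon> > 0\<close> by metis
  obtain d3 where d3: "d3 > 0" "cball x d3 \<subseteq> S"
    using S x open_contains_cball by blast
  define t where "t = min (min d1 d2) d3 / 3"
  have t: "t > 0" "2 * t < d1" "2 * t < d2" "2 * t \<le> d3"
    using d d3 by (auto simp: t_def)
  have sub: "cball x (2 * t) \<subseteq> S"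
    using d3 t by auto
  obtain y where y: "y \<in> cball x (2 * t)"
    "f (x + t *\<^sub>R axis i 1 + t *\<^sub>R axis j 1) - f (x + t *\<^sub>R axis i 1)
      - f (x + t *\<^sub>R axis j 1) + f x = t\<^sup>2 * ?b y"
    using second_difference_mean_value[OF S f sub t(1)] by blast
  obtain z where z: "z \<in> cball x (2 * t)"
    "f (x + t *\<^sub>R axis j 1 + t *\<^sub>R axis i 1) - f (x + t *\<^sub>R axis j 1)
      - f (x + t *\<^sub>R axis i 1) + f x = t\<^sup>2 * ?a z"
    using second_difference_mean_value[OF S f sub t(1)] by blast
  have "t\<^sup>2 * ?b y = t\<^sup>2 * ?a z"
    unfolding y(2)[symmetric] z(2)[symmetric] by (simp add: algebra_simps)
  then have "?b y = ?a z" using t by simp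
  moreover have "dist (?a z) (?a x) < \<epsilon>" "dist (?b y) (?b x) < \<epsilon>"
    using d(2)[of z] d(4)[of y] y z t by (auto simp: dist_commute)
  ultimately show False
    unfolding \<epsilon>_def dist_real_def by argo
qed

section \<open>Decay with parity\<close>

definition exterior :: "real \<Rightarrow> R3 set" where
  "exterior R = {x. norm x > R}"

lemma open_exterior: "open (exterior R)"
  unfolding exterior_def by (intro open_Collect_less continuous_intros)

lemma uminus_exterior [simp]: "- x \<in> exterior R \<longleftrightarrow> x \<in> exterior R"
  by (simp add: exterior_def)

lemma eventually_exterior: "eventually (\<lambda>x. x \<in> exterior R) at_infinity"
  unfolding exterior_def eventually_at_infinity by (auto intro!: exI[of _ "R + 1"])

abbreviation radial :: "real \<Rightarrow> R3 \<Rightarrow> real" where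
  "radial p \<equiv> \<lambda>x. norm x powr p"

lemma radial_mult: "radial p x * radial q x = radial (p + q) x"
  by (simp add: powr_add)

lemma radial_bigo_mono:
  assumes "p \<le> q"
  shows "radial p \<in> O[at_infinity](radial q)"
proof (rule bigoI[of _ 1])
  show "eventually (\<lambda>x. norm (radial p x) \<le> 1 * norm (radial q x)) at_infinity"
    unfolding eventually_at_infinity using assms by (auto intro!: exI[of _ 1] powr_mono)
qed

lemma bigo_radial_weaken:
  "f \<in> O[at_infinity](radial p) \<Longrightarrow> p \<le> q \<Longrightarrow> f \<in> O[at_infinity](radial q)"
  using landau_o.big.trans radial_bigo_mono by blast

lemma bigo_radial_reflect:
  assumes "f \<in> O[at_infinity](radial p)"
  shows "(\<lambda>x. f (- x)) \<in> O[at_infinity](radial p)"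
proof -
  have "filterlim (uminus :: R3 \<Rightarrow> R3) at_infinity at_infinity"
    unfolding filterlim_def le_filter_def eventually_filtermap eventually_at_infinity
    by (metis norm_minus_cancel)
  from landau_o.big.compose[OF assms this] show ?thesis
    by simp
qed

lemma bigo_radial_mult:
  assumes "f \<in> O[at_infinity](radial p)" "g \<in> O[at_infinity](radial q)" "p + q \<le> r"
  shows "(\<lambda>x. f x * g x) \<in> O[at_infinity](radial r)"
  using landau_o.big.trans[OF landau_o.big.mult[OF assms(1,2)]] radial_bigo_mono[OF assms(3)]
  by (simp add: radial_mult)

text \<open>
  \<open>s = 1\<close> stands for asymptotically even and \<open>s = -1\<close> for asymptotically odd functions of order
  \<open>|x|\<^sup>-\<^sup>p\<close>: the part of the wrong parity is smaller by one power of \<open>|x|\<close>. Continuity is included so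
  that every function of the class can be integrated over spheres.
\<close>

definition parity_decay :: "real \<Rightarrow> real \<Rightarrow> real \<Rightarrow> (R3 \<Rightarrow> real) \<Rightarrow> bool" where
  "parity_decay R s p f \<longleftrightarrow> continuous_on (exterior R) f \<and>
     f \<in> O[at_infinity](radial (- p)) \<and>
     (\<lambda>x. f x - s * f (- x)) \<in> O[at_infinity](radial (- p - 1))"

lemma parity_decay_continuous: "parity_decay R s p f \<Longrightarrow> continuous_on (exterior R) f"
  by (simp add: parity_decay_def)

lemma parity_decay_bigo: "parity_decay R s p f \<Longrightarrow> f \<in> O[at_infinity](radial (- p))"
  by (simp add: parity_decay_def)

lemma parity_decay_cong:
  assumes "parity_decay R s p f" "\<And>x. x \<in> exterior R \<Longrightarrow> f x = g x"
  shows "parity_decay R s p g"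
proof -
  have "eventually (\<lambda>x. f x = g x) at_infinity"
    using eventually_exterior[of R] by (rule eventually_mono) (rule assms(2))
  then have 1: "g \<in> O[at_infinity](radial (- p))"
    using parity_decay_bigo[OF assms(1)] by (rule landau_o.big.in_cong[THEN iffD1])
  have "eventually (\<lambda>x. f x - s * f (- x) = g x - s * g (- x)) at_infinity"
    using eventually_exterior[of R] by (rule eventually_mono) (simp add: assms(2))
  then have 2: "(\<lambda>x. g x - s * g (- x)) \<in> O[at_infinity](radial (- p - 1))"
    by (rule landau_o.big.in_cong[THEN iffD1]) (use assms(1) in \<open>simp add: parity_decay_def\<close>)
  have "continuous_on (exterior R) g"
    using parity_decay_continuous[OF assms(1)] assms(2) by (rule continuous_on_eq)
  with 1 2 show ?thesis
    by (simp add: parity_decay_def)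
qed

lemma parity_decay_mono:
  assumes "parity_decay R s p f" "q \<le> p"
  shows "parity_decay R s q f"
  using assms unfolding parity_decay_def
  by (auto elim: bigo_radial_weaken)

lemma parity_decay_zero: "parity_decay R s p (\<lambda>x. 0)"
  by (simp add: parity_decay_def)

lemma parity_decay_const: "parity_decay R 1 0 (\<lambda>x. a)"
proof -
  have "(\<lambda>x. a) \<in> O[at_infinity](radial 0)"
  proof (rule bigoI[of _ "\<bar>a\<bar>"])
    show "eventually (\<lambda>x. norm a \<le> \<bar>a\<bar> * norm (radial 0 x)) at_infinity"
      unfolding eventually_at_infinity by (intro exI[of _ 1]) auto
  qed
  then show ?thesis
    by (simp add: parity_decay_def)
qed

lemma parity_decay_add:
  assumes "parity_decay R s p f" "parity_decay R s p g"
  shows "parity_decay R s p (\<lambda>x. f x + g x)"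
proof -
  have "(\<lambda>x. (f x - s * f (- x)) + (g x - s * g (- x))) \<in> O[at_infinity](radial (- p - 1))"
    using assms unfolding parity_decay_def by (intro sum_in_bigo(1)) blast+
  then have "(\<lambda>x. (f x + g x) - s * (f (- x) + g (- x))) \<in> O[at_infinity](radial (- p - 1))"
    by (simp add: algebra_simps)
  moreover have "(\<lambda>x. f x + g x) \<in> O[at_infinity](radial (- p))"
    using assms by (intro sum_in_bigo(1) parity_decay_bigo)
  ultimately show ?thesis
    using assms by (simp add: parity_decay_def continuous_on_add)
qed

lemma parity_decay_cmult:
  assumes "parity_decay R s p f"
  shows "parity_decay R s p (\<lambda>x. a * f x)"
proof -
  have "(\<lambda>x. a * (f x - s * f (- x))) \<in> O[at_infinity](radial (- p - 1))"
    using assms unfolding parity_decay_def by (cases "a = 0") auto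
  then have "(\<lambda>x. a * f x - s * (a * f (- x))) \<in> O[at_infinity](radial (- p - 1))"
    by (simp add: algebra_simps)
  moreover have "(\<lambda>x. a * f x) \<in> O[at_infinity](radial (- p))"
    using parity_decay_bigo[OF assms] by (cases "a = 0") auto
  ultimately show ?thesis
    using assms by (simp add: parity_decay_def continuous_on_mult_left)
qed

lemma parity_decay_uminus:
  assumes "parity_decay R s p f"
  shows "parity_decay R s p (\<lambda>x. - f x)"
  using parity_decay_cmult[OF assms, of "-1"] by simp

lemma parity_decay_diff:
  assumes "parity_decay R s p f" "parity_decay R s p g"
  shows "parity_decay R s p (\<lambda>x. f x - g x)"
  using parity_decay_add[OF assms(1) parity_decay_uminus[OF assms(2)]] by simp

lemma parity_decay_sum:
  assumes "\<And>k. k \<in> I \<Longrightarrow> parity_decay R s p (f k)"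
  shows "parity_decay R s p (\<lambda>x. \<Sum>k\<in>I. f k x)"
  using assms
  by (induction I rule: infinite_finite_induct) (auto intro: parity_decay_zero parity_decay_add)

text \<open>
  Parities multiply and orders add, since
  \<open>f g - s t f\<^sup>- g\<^sup>- = (f - s f\<^sup>-) g + s f\<^sup>- (g - t g\<^sup>-)\<close> with \<open>f\<^sup>-(x) = f(-x)\<close>.
\<close>

lemma parity_decay_mult:
  assumes f: "parity_decay R s p f" and g: "parity_decay R t q g"
    and "u = s * t" "r \<le> p + q"
  shows "parity_decay R u r (\<lambda>x. f x * g x)"
proof -
  note f = f[unfolded parity_decay_def] and g = g[unfolded parity_decay_def]
  have "(\<lambda>x. (f x - s * f (- x)) * g x + s * (f (- x) * (g x - t * g (- x))))
      \<in> O[at_infinity](radial (- r - 1))"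
  proof (rule sum_in_bigo(1))
    show "(\<lambda>x. (f x - s * f (- x)) * g x) \<in> O[at_infinity](radial (- r - 1))"
      using f g \<open>r \<le> p + q\<close> by (intro bigo_radial_mult[of _ "- p - 1" _ "- q"]) auto
    have "(\<lambda>x. f (- x) * (g x - t * g (- x))) \<in> O[at_infinity](radial (- r - 1))"
      using f g \<open>r \<le> p + q\<close>
      by (intro bigo_radial_mult[of _ "- p" _ "- q - 1"] bigo_radial_reflect) auto
    then show "(\<lambda>x. s * (f (- x) * (g x - t * g (- x)))) \<in> O[at_infinity](radial (- r - 1))"
      by (cases "s = 0") simp_all
  qed
  then have "(\<lambda>x. f x * g x - u * (f (- x) * g (- x))) \<in> O[at_infinity](radial (- r - 1))"
    by (simp add: algebra_simps \<open>u = s * t\<close>)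
  moreover have "(\<lambda>x. f x * g x) \<in> O[at_infinity](radial (- r))"
    using f g \<open>r \<le> p + q\<close> by (intro bigo_radial_mult[of _ "- p" _ "- q"]) auto
  ultimately show ?thesis
    using f g by (auto simp: parity_decay_def intro: continuous_on_mult)
qed

lemma parity_decay_coord: "parity_decay R (-1) (-1) (\<lambda>x. x $ i)"
proof -
  have "(\<lambda>x::R3. x $ i) \<in> O[at_infinity](radial 1)"
    using component_le_norm_cart by (intro bigoI[of _ 1] always_eventually) (auto simp: powr_one)
  then show ?thesis
    by (auto simp: parity_decay_def intro!: continuous_intros)
qed

lemma parity_decay_normal:
  assumes "R \<ge> 0"
  shows "parity_decay R (-1) 0 (\<lambda>x. x $ i / norm x)"
proof -
  have "eventually (\<lambda>x::R3. norm (x $ i / norm x) \<le> 1 * norm (radial 0 x)) at_infinity"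
    unfolding eventually_at_infinity
    by (auto intro!: exI[of _ 1] simp: component_le_norm_cart divide_simps)
  then have "(\<lambda>x::R3. x $ i / norm x) \<in> O[at_infinity](radial (- 0))"
    by (intro bigoI[of _ 1]) simp
  moreover have "continuous_on (exterior R) (\<lambda>x. x $ i / norm x)"
    using assms by (intro continuous_intros) (auto simp: exterior_def)
  ultimately show ?thesis
    by (simp add: parity_decay_def)
qed

lemma parity_decay_tendsto_0:
  assumes "parity_decay R s p f" "p > 0"
  shows "(f \<longlongrightarrow> 0) at_infinity"
proof -
  have "filterlim (norm :: R3 \<Rightarrow> real) at_top at_infinity"
    by (rule filterlim_norm_at_top)
  then have lim: "((\<lambda>x. c * norm (radial (- p) x)) \<longlongrightarrow> 0) at_infinity" for c
    using tendsto_neg_powr[of "- p" norm at_infinity] \<open>p > 0\<close>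
    by (intro tendsto_mult_right_zero tendsto_norm_zero) auto
  obtain c where "eventually (\<lambda>x. norm (f x) \<le> c * norm (radial (- p) x)) at_infinity"
    using parity_decay_bigo[OF assms(1)] by (elim landau_o.bigE)
  then show ?thesis
    using lim[of c] by (rule Lim_null_comparison)
qed

text \<open>A nonlinear function of a perturbation of a constant: only a Lipschitz bound near the
  constant is needed, because both defining estimates compare two values of \<open>f\<close>.\<close>

lemma parity_decay_compose_lipschitz:
  assumes f: "parity_decay R 1 p (\<lambda>x. f x - a)" and "p > 0"
    and cont: "continuous_on (f ` exterior R) \<phi>"
    and lip: "\<And>u v. \<bar>u - a\<bar> < d \<Longrightarrow> \<bar>v - a\<bar> < d \<Longrightarrow> \<bar>\<phi> u - \<phi> v\<bar> \<le> L * \<bar>u - v\<bar>" and "d > 0"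
  shows "parity_decay R 1 p (\<lambda>x. \<phi> (f x) - \<phi> a)"
proof -
  note f' = f[unfolded parity_decay_def]
  have *: "eventually (\<lambda>x. \<bar>f x - a\<bar> < d) at_infinity"
    using tendstoD[OF parity_decay_tendsto_0[OF f \<open>p > 0\<close>] \<open>d > 0\<close>] by (simp add: dist_real_def)
  have **: "eventually (\<lambda>x. \<bar>f (- x) - a\<bar> < d) at_infinity"
    using * unfolding eventually_at_infinity by (metis norm_minus_cancel)
  have "(\<lambda>x. \<phi> (f x) - \<phi> a) \<in> O[at_infinity](\<lambda>x. f x - a)"
  proof (rule bigoI[of _ L])
    show "eventually (\<lambda>x. norm (\<phi> (f x) - \<phi> a) \<le> L * norm (f x - a)) at_infinity"
      using * by eventually_elim (use lip \<open>d > 0\<close> in auto)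
  qed
  then have 1: "(\<lambda>x. \<phi> (f x) - \<phi> a) \<in> O[at_infinity](radial (- p))"
    using f' landau_o.big.trans by blast
  have "(\<lambda>x. \<phi> (f x) - \<phi> (f (- x))) \<in> O[at_infinity](\<lambda>x. f x - f (- x))"
  proof (rule bigoI[of _ L])
    show "eventually (\<lambda>x. norm (\<phi> (f x) - \<phi> (f (- x))) \<le> L * norm (f x - f (- x))) at_infinity"
      using * ** by eventually_elim (use lip in auto)
  qed
  then have 2: "(\<lambda>x. \<phi> (f x) - \<phi> (f (- x))) \<in> O[at_infinity](radial (- p - 1))"
    using f' landau_o.big.trans by fastforce
  have "continuous_on (exterior R) f"
    using f' continuous_on_add[of "exterior R" "\<lambda>x. f x - a" "\<lambda>_. a"] by simp
  then have "continuous_on (exterior R) (\<lambda>x. \<phi> (f x))"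
    using continuous_on_compose2[OF cont] by blast
  with 1 2 show ?thesis
    by (auto simp: parity_decay_def intro!: continuous_intros)
qed

lemma C_on_pds: "C_on (n + length ks) f S \<Longrightarrow> C_on n (pds ks f) S"
proof (induction ks arbitrary: n)
  case (Cons k ks)
  then have "C_on (Suc n) (pds ks f) S"
    by (metis add_Suc add_Suc_right length_Cons)
  then show ?case
    by (simp add: pds_def)
qed (simp add: pds_def)

lemma pds_reflect:
  assumes "C_on (length ks) f (exterior R)" "x \<in> exterior R"
  shows "pds ks (\<lambda>x. f x - s * f (- x)) x = pds ks f x - s * (-1) ^ length ks * pds ks f (- x)"
  using assms
proof (induction ks arbitrary: x)
  case (Cons k ks)
  let ?S = "exterior R"
  have "C_on 1 (pds ks f) ?S"
    using Cons.prems(1) by (intro C_on_pds) simp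
  then have diff: "pds ks f differentiable (at y)" if "y \<in> ?S" for y
    using that by (rule C1_differentiable)
  then have diff': "(\<lambda>y. pds ks f (- y)) differentiable (at x)"
    using has_derivative_compose_uminus[of "pds ks f" x] Cons.prems(2)
    by (auto intro: differentiableI)
  have "C_on (length ks) f ?S"
    using Cons.prems(1) by (rule C_on_mono) simp
  then have "pd k (pds ks (\<lambda>x. f x - s * f (- x))) x
      = pd k (\<lambda>x. pds ks f x - s * (-1) ^ length ks * pds ks f (- x)) x"
    by (intro pd_cong[OF open_exterior Cons.prems(2)] Cons.IH)
  also have "\<dots> = pd k (pds ks f) x + s * (-1) ^ length ks * pd k (pds ks f) (- x)"
    using diff diff' Cons.prems(2)
    by (subst pd_diff) (auto simp: pd_cmult pd_compose_uminus intro!: differentiable_mult)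
  finally show ?case
    by (simp add: pds_def)
qed (simp add: pds_def)

text \<open>Each derivative gains a power of decay and, by the chain rule for \<open>x \<mapsto> -x\<close>, flips the parity.\<close>

lemma parity_decay_pds:
  assumes f: "decays n p f" and odd: "decays n (p + 1) (\<lambda>x. f x - s * f (- x))"
    and C: "C_on n f (exterior R)" and "length ks \<le> n"
  shows "parity_decay R (s * (-1) ^ length ks) (p + length ks) (pds ks f)"
proof -
  have "C_on 0 (pds ks f) (exterior R)"
    using C_on_mono[OF C \<open>length ks \<le> n\<close>] by (intro C_on_pds) simp
  moreover have "pds ks f \<in> O[at_infinity](radial (- (p + length ks)))"
    using f \<open>length ks \<le> n\<close> by (auto simp: decays_def)
  moreover have "(\<lambda>x. pds ks f x - s * (-1) ^ length ks * pds ks f (- x))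
      \<in> O[at_infinity](radial (- (p + length ks) - 1))"
  proof (rule landau_o.big.in_cong[THEN iffD1])
    show "eventually (\<lambda>x. pds ks (\<lambda>x. f x - s * f (- x)) x
        = pds ks f x - s * (-1) ^ length ks * pds ks f (- x)) at_infinity"
      using eventually_exterior[of R]
      by (rule eventually_mono) (rule pds_reflect[OF C_on_mono[OF C \<open>length ks \<le> n\<close>]])
    show "pds ks (\<lambda>x. f x - s * f (- x)) \<in> O[at_infinity](radial (- (p + length ks) - 1))"
      using odd[unfolded decays_def, rule_format, OF \<open>length ks \<le> n\<close>]
      by (rule bigo_radial_weaken) simp
  qed
  ultimately show ?thesis
    by (simp add: parity_decay_def)
qed

section \<open>Euclidean sphere integrals\<close>

lemma sphere_param_eq:
  "sphere_param r \<theta> \<phi> = (r * sin \<theta> * cos \<phi>) *\<^sub>R axis 1 1 + (r * sin \<theta> * sin \<phi>) *\<^sub>R axis 2 1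
     + (r * cos \<theta>) *\<^sub>R axis 3 1"
  by (simp add: sphere_param_def vec_eq_iff forall_3 axis_def)

lemma sphere_param_nth [simp]:
  "sphere_param r \<theta> \<phi> $ 1 = r * sin \<theta> * cos \<phi>"
  "sphere_param r \<theta> \<phi> $ 2 = r * sin \<theta> * sin \<phi>"
  "sphere_param r \<theta> \<phi> $ 3 = r * cos \<theta>"
  by (simp_all add: sphere_param_def)

lemma sphere_param_scale: "sphere_param r \<theta> \<phi> = r *\<^sub>R sphere_param 1 \<theta> \<phi>"
  by (simp add: vec_eq_iff forall_3)

lemma norm_sphere_param [simp]: "norm (sphere_param r \<theta> \<phi>) = \<bar>r\<bar>"
proof -
  have "(sphere_param r \<theta> \<phi>) \<bullet> (sphere_param r \<theta> \<phi>)
      = r\<^sup>2 * ((sin \<theta>)\<^sup>2 * ((cos \<phi>)\<^sup>2 + (sin \<phi>)\<^sup>2) + (cos \<theta>)\<^sup>2)"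
    unfolding inner_vec_def sum_3 power2_eq_square sphere_param_nth inner_real_def by algebra
  then show ?thesis
    by (simp add: norm_eq_sqrt_inner)
qed

lemma sphere_param_antipode: "sphere_param r (pi - \<theta>) (\<phi> + pi) = - sphere_param r \<theta> \<phi>"
  by (simp add: vec_eq_iff forall_3)

lemma sphere_param_exterior: "r > R \<Longrightarrow> 0 \<le> R \<Longrightarrow> sphere_param r \<theta> \<phi> \<in> exterior R"
  by (simp add: exterior_def)

abbreviation angles :: "(real \<times> real) set" where
  "angles \<equiv> {0..pi} \<times> {0..2 * pi}"

lemma angles_cbox: "angles = cbox (0, 0) (pi, 2 * pi)"
  by (simp add: cbox_Pair_eq)

definition round_integral :: "real \<Rightarrow> (R3 \<Rightarrow> real) \<Rightarrow> real" where
  "round_integral r f = integral angles (\<lambda>z. f (sphere_param r (fst z) (snd z)) * (r\<^sup>2 * sin (fst z)))"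

lemma continuous_on_sphere_param [continuous_intros]:
  fixes T :: "'a::t2_space set"
  assumes "continuous_on T a" "continuous_on T b" "continuous_on T c"
  shows "continuous_on T (\<lambda>z. sphere_param (a z) (b z) (c z))"
  unfolding sphere_param_eq using assms by (intro continuous_intros)

lemma round_integrand_continuous:
  assumes "continuous_on (exterior R) f" "0 \<le> R" "R < r"
  shows "continuous_on T (\<lambda>z. f (sphere_param r (fst z) (snd z)) * (r\<^sup>2 * sin (fst z)))"
  by (intro continuous_intros continuous_on_compose2[OF assms(1)])
     (use assms in \<open>auto intro: sphere_param_exterior\<close>)

lemma round_integrand_integrable:
  assumes "continuous_on (exterior R) f" "0 \<le> R" "R < r"
  shows "(\<lambda>z. f (sphere_param r (fst z) (snd z)) * (r\<^sup>2 * sin (fst z))) integrable_on angles"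
  unfolding angles_cbox by (intro integrable_continuous round_integrand_continuous[OF assms])

lemma round_integral_cong:
  assumes "\<And>x. norm x = r \<Longrightarrow> f x = g x" "r \<ge> 0"
  shows "round_integral r f = round_integral r g"
  unfolding round_integral_def using assms by (intro integral_cong) auto

lemma round_integral_add:
  assumes "continuous_on (exterior R) f" "continuous_on (exterior R) g" "0 \<le> R" "R < r"
  shows "round_integral r (\<lambda>x. f x + g x) = round_integral r f + round_integral r g"
  using integral_add[OF round_integrand_integrable[OF assms(1,3,4)]
      round_integrand_integrable[OF assms(2,3,4)]]
  by (simp add: round_integral_def distrib_right)

lemma round_integral_cmult: "round_integral r (\<lambda>x. a * f x) = a * round_integral r f"
  by (simp add: round_integral_def mult.assoc)

lemma round_integral_diff:
  assumes "continuous_on (exterior R) f" "continuous_on (exterior R) g" "0 \<le> R" "R < r"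
  shows "round_integral r (\<lambda>x. f x - g x) = round_integral r f - round_integral r g"
  using integral_diff[OF round_integrand_integrable[OF assms(1,3,4)]
      round_integrand_integrable[OF assms(2,3,4)]]
  by (simp add: round_integral_def left_diff_distrib)

lemma round_integral_sum:
  assumes "\<And>k. k \<in> I \<Longrightarrow> continuous_on (exterior R) (f k)" "0 \<le> R" "R < r"
  shows "round_integral r (\<lambda>x. \<Sum>k\<in>I. f k x) = (\<Sum>k\<in>I. round_integral r (f k))"
  using assms(1)
proof (induction I rule: infinite_finite_induct)
  case (insert k I)
  then show ?case
    using round_integral_add[of R "f k" "\<lambda>x. \<Sum>k\<in>I. f k x" r] assms(2,3)
    by (auto intro: continuous_on_sum)
qed (simp_all add: round_integral_def)

text \<open>
  In angles the antipodal map is \<open>(\<theta>, \<phi>) \<mapsto> (\<pi> - \<theta>, \<phi> + \<pi>)\<close>: a reflection of the range of \<open>\<theta>\<close> and a shift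
  by half a period of \<open>\<phi>\<close>.
\<close>

lemma round_integral_reflect:
  assumes f: "continuous_on (exterior R) f" "0 \<le> R" "R < r"
  shows "round_integral r (\<lambda>x. f (- x)) = round_integral r f"
proof -
  define g where "g = (\<lambda>z. f (sphere_param r (fst z) (snd z)) * (r\<^sup>2 * sin (fst z)))"
  define I where "I \<theta> = integral {0..2 * pi} (\<lambda>\<phi>. g (\<theta>, \<phi>))" for \<theta>
  have g: "continuous_on T g" for T
    unfolding g_def by (rule round_integrand_continuous[OF f])
  have g_slice: "continuous_on T (\<lambda>\<phi>. g (\<theta>, \<phi>))" for T \<theta>
    by (rule continuous_on_compose2[OF g[of UNIV]]) (auto intro!: continuous_intros)
  have periodic: "g (\<theta>, \<phi> + 2 * pi) = g (\<theta>, \<phi>)" for \<theta> \<phi>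
    by (simp add: g_def sphere_param_def)
  have "integral {0..2 * pi} (\<lambda>\<phi>. g (\<theta>, \<phi> + pi)) = I \<theta>" for \<theta>
  proof -
    have int: "(\<lambda>\<phi>. g (\<theta>, \<phi>)) integrable_on {a..b}" for a b
      by (intro integrable_continuous_real g_slice)
    have "integral {0..2 * pi} (\<lambda>\<phi>. g (\<theta>, \<phi> + pi)) = integral {pi..3 * pi} (\<lambda>\<phi>. g (\<theta>, \<phi>))"
      using integral_shift_real_ivl[of pi pi "3 * pi" "\<lambda>\<phi>. g (\<theta>, \<phi>)"] by simp
    also have "\<dots> = integral {pi..2 * pi} (\<lambda>\<phi>. g (\<theta>, \<phi>)) + integral {2 * pi..3 * pi} (\<lambda>\<phi>. g (\<theta>, \<phi>))"
      using int by (intro Henstock_Kurzweil_Integration.integral_combine[symmetric]) auto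
    also have "integral {2 * pi..3 * pi} (\<lambda>\<phi>. g (\<theta>, \<phi>)) = integral {0..pi} (\<lambda>\<phi>. g (\<theta>, \<phi>))"
      using integral_shift_real_ivl[of "2 * pi" "2 * pi" "3 * pi" "\<lambda>\<phi>. g (\<theta>, \<phi>)"]
      by (simp add: periodic)
    also have "integral {pi..2 * pi} (\<lambda>\<phi>. g (\<theta>, \<phi>)) + integral {0..pi} (\<lambda>\<phi>. g (\<theta>, \<phi>)) = I \<theta>"
      unfolding I_def using int
      by (subst add.commute) (intro Henstock_Kurzweil_Integration.integral_combine, auto)
    finally show ?thesis .
  qed
  note shift = this
  have "round_integral r (\<lambda>x. f (- x)) = integral angles (\<lambda>z. g (pi - fst z, snd z + pi))"
    by (simp add: round_integral_def g_def sphere_param_antipode)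
  also have "\<dots> = integral {0..pi} (\<lambda>\<theta>. integral {0..2 * pi} (\<lambda>\<phi>. g (pi - \<theta>, \<phi> + pi)))"
    unfolding angles_cbox
    by (subst integral_prod_continuous)
       (auto intro!: continuous_intros continuous_on_compose2[OF g[of UNIV]])
  also have "\<dots> = integral {0..pi} (\<lambda>\<theta>. I (pi - \<theta>))"
    by (simp add: shift)
  also have "\<dots> = integral {-pi..0} (\<lambda>\<theta>. I (\<theta> + pi))"
    using Henstock_Kurzweil_Integration.integral_reflect_real[of 0 "-pi" "\<lambda>\<theta>. I (\<theta> + pi)"]
    by (simp add: add.commute)
  also have "\<dots> = integral {0..pi} I"
    using integral_shift_real_ivl[of 0 pi pi I] by simp
  also have "\<dots> = round_integral r f"
    unfolding round_integral_def I_def angles_cbox g_def[symmetric]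
    by (subst integral_prod_continuous) (auto intro!: g)
  finally show ?thesis .
qed

text \<open>
  The estimate that the whole argument rests on. Counting powers alone gives \<open>O(r\<^sup>2\<^sup>-\<^sup>p)\<close>; averaging the
  integrand with its reflection leaves only the even part, which is smaller by a factor \<open>1/r\<close>.
\<close>

lemma round_integral_odd_bigo:
  assumes f: "parity_decay R (-1) p f" and "0 \<le> R"
  shows "(\<lambda>r. round_integral r f) \<in> O[at_top](\<lambda>r. r powr (1 - p))"
proof -
  have cont: "continuous_on (exterior R) f"
    using f by (rule parity_decay_continuous)
  then have cont': "continuous_on (exterior R) (\<lambda>x. f (- x))"
    by (rule continuous_on_compose2) (auto intro!: continuous_intros)
  obtain c where "c > 0"
    "eventually (\<lambda>x. norm (f x + f (- x)) \<le> c * norm (radial (- p - 1) x)) at_infinity"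
    using f by (auto simp: parity_decay_def elim: landau_o.bigE)
  then obtain N where N: "\<And>x. norm x \<ge> N \<Longrightarrow> \<bar>f x + f (- x)\<bar> \<le> c * radial (- p - 1) x"
    by (auto simp: eventually_at_infinity)
  define C where "C = c * measure lborel (cbox (0, 0) (pi, 2 * pi :: real))"
  have bound: "\<bar>round_integral r f\<bar> \<le> C * r powr (1 - p)" if "r > R" "r \<ge> N" "r > 0" for r
  proof -
    have "2 * round_integral r f = round_integral r f + round_integral r (\<lambda>x. f (- x))"
      using round_integral_reflect[OF cont \<open>0 \<le> R\<close> \<open>r > R\<close>] by simp
    also have "\<dots> = round_integral r (\<lambda>x. f x + f (- x))"
      by (rule round_integral_add[OF cont cont' \<open>0 \<le> R\<close> \<open>r > R\<close>, symmetric])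
    finally have "2 * \<bar>round_integral r f\<bar> = \<bar>round_integral r (\<lambda>x. f x + f (- x))\<bar>"
      by linarith
    also have "\<dots> \<le> (c * r powr (1 - p)) * measure lborel (cbox (0, 0) (pi, 2 * pi :: real))"
    proof -
      have "norm ((f (sphere_param r (fst z) (snd z)) + f (- sphere_param r (fst z) (snd z)))
          * (r\<^sup>2 * sin (fst z))) \<le> c * r powr (1 - p)" for z :: "real \<times> real"
      proof -
        have "\<bar>(f (sphere_param r \<theta> \<phi>) + f (- sphere_param r \<theta> \<phi>)) * (r\<^sup>2 * sin \<theta>)\<bar>
            \<le> (c * r powr (- p - 1)) * (r\<^sup>2 * 1)" for \<theta> \<phi>
          unfolding abs_mult using N[of "sphere_param r \<theta> \<phi>"] that \<open>c > 0\<close>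
          by (intro mult_mono) auto
        also have "\<dots> = c * r powr (1 - p)"
          using \<open>r > 0\<close> by (simp add: powr_add[symmetric] flip: powr_numeral)
        finally show ?thesis
          by simp
      qed
      then show ?thesis
        using has_integral_bound[OF _ integrable_integral[OF round_integrand_integrable[OF
              continuous_on_add[OF cont cont'] \<open>0 \<le> R\<close> \<open>r > R\<close>, unfolded angles_cbox]]] \<open>c > 0\<close>
        unfolding round_integral_def angles_cbox by (auto simp: less_imp_le)
    qed
    finally show ?thesis
      using \<open>c > 0\<close> by (simp add: C_def mult_ac)
  qed
  show ?thesis
  proof (rule bigoI[of _ C])
    show "eventually (\<lambda>r. norm (round_integral r f) \<le> C * norm (r powr (1 - p))) at_top"
      using eventually_gt_at_top[of R] eventually_ge_at_top[of N] eventually_gt_at_top[of 0]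
      by eventually_elim (use bound in auto)
  qed
qed

text \<open>
  A \<open>\<phi>\<close>-derivative integrates to zero by periodicity, a \<open>\<theta>\<close>-derivative if the primitive takes the same
  value at both poles.
\<close>

lemma round_integral_derivative_phi:
  assumes "\<And>\<theta> \<phi>. ((\<lambda>\<phi>. v \<theta> \<phi>) has_vector_derivative v' (\<theta>, \<phi>)) (at \<phi>)"
    and "continuous_on angles v'" and "\<And>\<theta>. v \<theta> (2 * pi) = (v \<theta> 0 :: real)"
  shows "(v' has_integral 0) angles"
proof -
  have "integral angles v' = integral {0..pi} (\<lambda>\<theta>. integral {0..2 * pi} (\<lambda>\<phi>. v' (\<theta>, \<phi>)))"
    using integral_prod_continuous[of 0 0 pi "2 * pi" v'] assms(2)
    by (simp add: angles_cbox)
  moreover have "integral {0..2 * pi} (\<lambda>\<phi>. v' (\<theta>, \<phi>)) = 0" for \<theta>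
    using fundamental_theorem_of_calculus[of 0 "2 * pi" "v \<theta>" "\<lambda>\<phi>. v' (\<theta>, \<phi>)"]
      has_vector_derivative_at_within[OF assms(1)] assms(3)
    by (auto simp: has_integral_iff)
  moreover have "v' integrable_on angles"
    using assms(2) unfolding angles_cbox by (rule integrable_continuous)
  ultimately show ?thesis
    by (simp add: has_integral_iff)
qed

lemma round_integral_derivative_theta:
  assumes "\<And>\<theta> \<phi>. ((\<lambda>\<theta>. u \<theta> \<phi>) has_vector_derivative u' (\<theta>, \<phi>)) (at \<theta>)"
    and "continuous_on angles u'" and "\<And>\<phi>. u pi \<phi> = (u 0 \<phi> :: real)"
  shows "(u' has_integral 0) angles"
proof -
  have "integral angles u' = integral {0..2 * pi} (\<lambda>\<phi>. integral {0..pi} (\<lambda>\<theta>. u' (\<theta>, \<phi>)))"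
    using integral_prod_continuous[of 0 0 pi "2 * pi" u']
      integral_swap_continuous[of 0 0 pi "2 * pi" "\<lambda>\<theta> \<phi>. u' (\<theta>, \<phi>)"] assms(2)
    by (simp add: angles_cbox)
  moreover have "integral {0..pi} (\<lambda>\<theta>. u' (\<theta>, \<phi>)) = 0" for \<phi>
    using fundamental_theorem_of_calculus[of 0 "pi" "\<lambda>\<theta>. u \<theta> \<phi>" "\<lambda>\<theta>. u' (\<theta>, \<phi>)"]
      has_vector_derivative_at_within[OF assms(1)] assms(3)
    by (auto simp: has_integral_iff)
  moreover have "u' integrable_on angles"
    using assms(2) unfolding angles_cbox by (rule integrable_continuous)
  ultimately show ?thesis
    by (simp add: has_integral_iff)
qed

lemma has_vector_derivative_sphere_param_theta:
  "((\<lambda>\<theta>. sphere_param r \<theta> \<phi>) has_vector_derivative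
     vector [r * cos \<theta> * cos \<phi>, r * cos \<theta> * sin \<phi>, - r * sin \<theta>]) (at \<theta>)"
proof -
  have "((\<lambda>\<theta>. sphere_param r \<theta> \<phi>) has_vector_derivative
      (r * cos \<theta> * cos \<phi>) *\<^sub>R axis 1 1 + (r * cos \<theta> * sin \<phi>) *\<^sub>R axis 2 1
        + (- r * sin \<theta>) *\<^sub>R axis 3 1) (at \<theta>)"
    unfolding sphere_param_eq has_vector_derivative_def
    by (auto intro!: derivative_eq_intros simp: algebra_simps)
  also have "(r * cos \<theta> * cos \<phi>) *\<^sub>R axis 1 1 + (r * cos \<theta> * sin \<phi>) *\<^sub>R axis 2 1
        + (- r * sin \<theta>) *\<^sub>R axis 3 1 = (vector [r * cos \<theta> * cos \<phi>, r * cos \<theta> * sin \<phi>, - r * sin \<theta>]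
            :: R3)"
    by (simp add: vec_eq_iff forall_3 axis_def)
  finally show ?thesis .
qed

lemma has_vector_derivative_sphere_param_phi:
  "((\<lambda>\<phi>. sphere_param r \<theta> \<phi>) has_vector_derivative
     vector [- r * sin \<theta> * sin \<phi>, r * sin \<theta> * cos \<phi>, 0]) (at \<phi>)"
proof -
  have "((\<lambda>\<phi>. sphere_param r \<theta> \<phi>) has_vector_derivative
      (- r * sin \<theta> * sin \<phi>) *\<^sub>R axis 1 1 + (r * sin \<theta> * cos \<phi>) *\<^sub>R axis 2 1) (at \<phi>)"
    unfolding sphere_param_eq has_vector_derivative_def
    by (auto intro!: derivative_eq_intros simp: algebra_simps)
  also have "(- r * sin \<theta> * sin \<phi>) *\<^sub>R axis 1 1 + (r * sin \<theta> * cos \<phi>) *\<^sub>R axis 2 1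
       = (vector [- r * sin \<theta> * sin \<phi>, r * sin \<theta> * cos \<phi>, 0] :: R3)"
    by (simp add: vec_eq_iff forall_3 axis_def)
  finally show ?thesis .
qed

text \<open>
  The rotation fields \<open>x\<^sub>i \<partial>\<^sub>j - x\<^sub>j \<partial>\<^sub>i\<close> are tangent to the sphere and preserve its area, so a
  derivative along them integrates to zero. This is the form in which Stokes' theorem is used
  below. In angles the rotation about the third axis is \<open>\<partial>\<^sub>\<phi>\<close>, and the other two, multiplied by the density \<open>sin \<theta>\<close>, are
  total derivatives:
  \<open>sin \<theta> (x\<^sub>3 \<partial>\<^sub>1 - x\<^sub>1 \<partial>\<^sub>3) f = \<partial>\<^sub>\<theta> (sin \<theta> cos \<phi> f) - \<partial>\<^sub>\<phi> (cos \<theta> sin \<phi> f)\<close> and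
  \<open>sin \<theta> (x\<^sub>3 \<partial>\<^sub>2 - x\<^sub>2 \<partial>\<^sub>3) f = \<partial>\<^sub>\<theta> (sin \<theta> sin \<phi> f) + \<partial>\<^sub>\<phi> (cos \<theta> cos \<phi> f)\<close>.
\<close>

lemma round_integral_rotation:
  assumes f: "C_on 1 f (exterior R)" and R: "0 \<le> R" "R < r"
  shows "round_integral r (\<lambda>x. x $ i * pd j f x - x $ j * pd i f x) = 0"
proof -
  let ?P = "\<lambda>z. sphere_param r (fst z) (snd z)"
  let ?d = "\<lambda>k z. pd k f (?P z)"
  define F where "F \<theta> \<phi> = f (sphere_param r \<theta> \<phi>)" for \<theta> \<phi>
  define F\<^sub>\<theta> where "F\<^sub>\<theta> z = r * cos (fst z) * cos (snd z) * ?d 1 z + r * cos (fst z) * sin (snd z) *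
      ?d 2 z
      - r * sin (fst z) * ?d 3 z" for z
  define F\<^sub>\<phi> where "F\<^sub>\<phi> z = - r * sin (fst z) * sin (snd z) * ?d 1 z
      + r * sin (fst z) * cos (snd z) * ?d 2 z" for z
  have P: "sphere_param r \<theta> \<phi> \<in> exterior R" for \<theta> \<phi>
    using R by (intro sphere_param_exterior)
  note diff = C1_differentiable[OF f P]
  have D\<theta>: "((\<lambda>\<theta>. F \<theta> \<phi>) has_real_derivative F\<^sub>\<theta> (\<theta>, \<phi>)) (at \<theta>)" for \<theta> \<phi>
    unfolding F_def F\<^sub>\<theta>_def has_real_derivative_iff_has_vector_derivative
    by (rule has_vector_derivative_along[OF has_vector_derivative_sphere_param_theta diff, THEN
          has_vector_derivative_eq_rhs]) (simp add: sum_3)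
  have D\<phi>: "((\<lambda>\<phi>. F \<theta> \<phi>) has_real_derivative F\<^sub>\<phi> (\<theta>, \<phi>)) (at \<phi>)" for \<theta> \<phi>
    unfolding F_def F\<^sub>\<phi>_def has_real_derivative_iff_has_vector_derivative
    by (rule has_vector_derivative_along[OF has_vector_derivative_sphere_param_phi diff, THEN
          has_vector_derivative_eq_rhs]) (simp add: sum_3)
  have cd: "continuous_on angles (?d k)" for k
  proof -
    have "continuous_on (exterior R) (pd k f)"
      using f unfolding C_on_1 by blast
    then show ?thesis
      by (rule continuous_on_compose2) (intro continuous_intros, use P in auto)
  qed
  have cF: "continuous_on angles (\<lambda>z. F (fst z) (snd z))"
    unfolding F_def
    by (rule continuous_on_compose2[OF C_on_continuous[OF f]]) (intro continuous_intros, use P in auto)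
  have cF\<theta>: "continuous_on angles F\<^sub>\<theta>" and cF\<phi>: "continuous_on angles F\<^sub>\<phi>"
    unfolding F\<^sub>\<theta>_def F\<^sub>\<phi>_def by (intro continuous_intros cd)+
  have F_periodic: "F \<theta> (2 * pi) = F \<theta> 0" for \<theta>
    by (simp add: F_def sphere_param_def)
  have rot12: "round_integral r (\<lambda>x. x $ 1 * pd 2 f x - x $ 2 * pd 1 f x) = 0"
  proof -
    have "((\<lambda>z. r\<^sup>2 * sin (fst z) * F\<^sub>\<phi> z) has_integral 0) angles"
      by (rule round_integral_derivative_phi[of "\<lambda>\<theta> \<phi>. r\<^sup>2 * sin \<theta> * F \<theta> \<phi>"])
         (auto intro!: derivative_eq_intros D\<phi> continuous_intros cF\<phi>
           simp: has_real_derivative_iff_has_vector_derivative[symmetric] F_periodic)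
    then show ?thesis
      unfolding round_integral_def
      by (simp add: F\<^sub>\<phi>_def has_integral_iff algebra_simps)
  qed
  have rot31: "round_integral r (\<lambda>x. x $ 3 * pd 1 f x - x $ 1 * pd 3 f x) = 0"
  proof -
    have I1: "((\<lambda>z. r\<^sup>2 * (cos (fst z) * cos (snd z) * F (fst z) (snd z) + sin (fst z) * cos (snd z)
        * F\<^sub>\<theta> z))
        has_integral 0) angles"
    proof (rule round_integral_derivative_theta[of "\<lambda>\<theta> \<phi>. r\<^sup>2 * (sin \<theta> * cos \<phi> * F \<theta> \<phi>)"], goal_cases)
      case 1
      show ?case
        unfolding has_real_derivative_iff_has_vector_derivative[symmetric]
        by (auto intro!: derivative_eq_intros D\<theta> simp: algebra_simps)
    next
      case 2
      show ?case by (intro continuous_intros cF\<theta> cF)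
    qed (simp add: F_periodic)
    have I2: "((\<lambda>z. r\<^sup>2 * (cos (fst z) * cos (snd z) * F (fst z) (snd z) + cos (fst z) * sin (snd z)
        * F\<^sub>\<phi> z))
        has_integral 0) angles"
    proof (rule round_integral_derivative_phi[of "\<lambda>\<theta> \<phi>. r\<^sup>2 * (cos \<theta> * sin \<phi> * F \<theta> \<phi>)"], goal_cases)
      case 1
      show ?case
        unfolding has_real_derivative_iff_has_vector_derivative[symmetric]
        by (auto intro!: derivative_eq_intros D\<phi> simp: algebra_simps)
    next
      case 2
      show ?case by (intro continuous_intros cF\<phi> cF)
    qed (simp add: F_periodic)
    have "((\<lambda>z. r\<^sup>2 * (sin (fst z) * cos (snd z) * F\<^sub>\<theta> z - cos (fst z) * sin (snd z) * F\<^sub>\<phi> z))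
        has_integral 0) angles"
      using has_integral_diff[OF I1 I2] by (simp add: algebra_simps)
    moreover have "r\<^sup>2 * (sin (fst z) * cos (snd z) * F\<^sub>\<theta> z - cos (fst z) * sin (snd z) * F\<^sub>\<phi> z)
        = (?P z $ 3 * ?d 1 z - ?P z $ 1 * ?d 3 z) * (r\<^sup>2 * sin (fst z))" for z
    proof -
      have *: "sin (fst z) * cos (snd z) * F\<^sub>\<theta> z - cos (fst z) * sin (snd z) * F\<^sub>\<phi> z
          = r * sin (fst z) * (cos (fst z) * ((cos (snd z))\<^sup>2 + (sin (snd z))\<^sup>2) * ?d 1 z
              - sin (fst z) * cos (snd z) * ?d 3 z)"
        unfolding F\<^sub>\<theta>_def F\<^sub>\<phi>_def power2_eq_square by algebra
      show ?thesis
        unfolding * sphere_param_nth sin_cos_squared_add2 by algebra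
    qed
    ultimately show ?thesis
      unfolding round_integral_def by (simp add: has_integral_iff)
  qed
  have rot32: "round_integral r (\<lambda>x. x $ 3 * pd 2 f x - x $ 2 * pd 3 f x) = 0"
  proof -
    have I1: "((\<lambda>z. r\<^sup>2 * (cos (fst z) * sin (snd z) * F (fst z) (snd z) + sin (fst z) * sin (snd z)
        * F\<^sub>\<theta> z))
        has_integral 0) angles"
    proof (rule round_integral_derivative_theta[of "\<lambda>\<theta> \<phi>. r\<^sup>2 * (sin \<theta> * sin \<phi> * F \<theta> \<phi>)"], goal_cases)
      case 1
      show ?case
        unfolding has_real_derivative_iff_has_vector_derivative[symmetric]
        by (auto intro!: derivative_eq_intros D\<theta> simp: algebra_simps)
    next
      case 2
      show ?case by (intro continuous_intros cF\<theta> cF)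
    qed (simp add: F_periodic)
    have I2: "((\<lambda>z. r\<^sup>2 * (- (cos (fst z) * sin (snd z) * F (fst z) (snd z)) + cos (fst z) * cos
        (snd z) * F\<^sub>\<phi> z))
        has_integral 0) angles"
    proof (rule round_integral_derivative_phi[of "\<lambda>\<theta> \<phi>. r\<^sup>2 * (cos \<theta> * cos \<phi> * F \<theta> \<phi>)"], goal_cases)
      case 1
      show ?case
        unfolding has_real_derivative_iff_has_vector_derivative[symmetric]
        by (auto intro!: derivative_eq_intros D\<phi> simp: algebra_simps)
    next
      case 2
      show ?case by (intro continuous_intros cF\<phi> cF)
    qed (simp add: F_periodic)
    have "((\<lambda>z. r\<^sup>2 * (sin (fst z) * sin (snd z) * F\<^sub>\<theta> z + cos (fst z) * cos (snd z) * F\<^sub>\<phi> z))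
        has_integral 0) angles"
      using has_integral_add[OF I1 I2] by (simp add: algebra_simps)
    moreover have "r\<^sup>2 * (sin (fst z) * sin (snd z) * F\<^sub>\<theta> z + cos (fst z) * cos (snd z) * F\<^sub>\<phi> z)
        = (?P z $ 3 * ?d 2 z - ?P z $ 2 * ?d 3 z) * (r\<^sup>2 * sin (fst z))" for z
    proof -
      have *: "sin (fst z) * sin (snd z) * F\<^sub>\<theta> z + cos (fst z) * cos (snd z) * F\<^sub>\<phi> z
          = r * sin (fst z) * (cos (fst z) * ((cos (snd z))\<^sup>2 + (sin (snd z))\<^sup>2) * ?d 2 z
              - sin (fst z) * sin (snd z) * ?d 3 z)"
        unfolding F\<^sub>\<theta>_def F\<^sub>\<phi>_def power2_eq_square by algebra
      show ?thesis
        unfolding * sphere_param_nth sin_cos_squared_add2 by algebra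
    qed
    ultimately show ?thesis
      unfolding round_integral_def by (simp add: has_integral_iff)
  qed
  have swap: "round_integral r (\<lambda>x. x $ j * pd i f x - x $ i * pd j f x)
      = - round_integral r (\<lambda>x. x $ i * pd j f x - x $ j * pd i f x)" for i j
    using round_integral_cmult[of r "-1" "\<lambda>x. x $ i * pd j f x - x $ j * pd i f x"] by simp
  show ?thesis
    using exhaust_3[of i] exhaust_3[of j] rot12 rot31 rot32 swap[of 1 2] swap[of 3 1] swap[of 3 2]
    by (auto simp: round_integral_def)
qed

text \<open>
  By antisymmetry \<open>2 \<Sum> x\<^sub>j \<partial>\<^sub>k A\<^sub>j\<^sub>k = \<Sum> (x\<^sub>j \<partial>\<^sub>k - x\<^sub>k \<partial>\<^sub>j) A\<^sub>j\<^sub>k\<close>, a sum of rotational derivatives.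
\<close>

lemma round_flux_antisymmetric_divergence:
  fixes A :: "3 \<Rightarrow> 3 \<Rightarrow> R3 \<Rightarrow> real"
  assumes A: "\<And>j k. C_on 1 (A j k) (exterior R)" and R: "0 \<le> R" "R < r"
    and anti: "\<And>j k x. A k j x = - A j k x"
  shows "round_integral r (\<lambda>x. \<Sum>j\<in>UNIV. (\<Sum>k\<in>UNIV. pd k (A j k) x) * (x $ j / norm x)) = 0"
proof -
  have pdA: "pd l (A k j) x = - pd l (A j k) x" if "x \<in> exterior R" for l j k x
  proof -
    have "A k j = (\<lambda>x. -1 * A j k x)"
      using anti[of k j] by (simp add: fun_eq_iff)
    then show ?thesis
      using pd_cmult[OF C1_differentiable[OF A that], of l "-1" j k] by simp
  qed
  have "round_integral r (\<lambda>x. \<Sum>j\<in>UNIV. (\<Sum>k\<in>UNIV. pd k (A j k) x) * (x $ j / norm x))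
      = round_integral r (\<lambda>x. 1 / (2 * r) * (\<Sum>j\<in>UNIV. \<Sum>k\<in>UNIV. x $ j * pd k (A j k) x - x $ k * pd j
          (A j k) x))"
  proof (rule round_integral_cong)
    fix x :: R3 assume x: "norm x = r"
    then have "x \<in> exterior R" using R by (simp add: exterior_def)
    have "(\<Sum>j\<in>UNIV. \<Sum>k\<in>UNIV. x $ k * pd j (A j k) x) = - (\<Sum>j\<in>UNIV. \<Sum>k\<in>UNIV. x $ j * pd k (A j k) x)"
    proof -
      have "x $ k * pd j (A j k) x = - (x $ k * pd j (A k j) x)" for j k
        using pdA[OF \<open>x \<in> exterior R\<close>, of j j k] by simp
      then show ?thesis
        by (subst sum.swap) (simp only: sum_negf)
    qed
    then have "(\<Sum>j\<in>UNIV. \<Sum>k\<in>UNIV. x $ j * pd k (A j k) x - x $ k * pd j (A j k) x)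
        = 2 * (\<Sum>j\<in>UNIV. \<Sum>k\<in>UNIV. x $ j * pd k (A j k) x)"
      by (simp add: sum_subtractf)
    then show "(\<Sum>j\<in>UNIV. (\<Sum>k\<in>UNIV. pd k (A j k) x) * (x $ j / norm x))
      = 1 / (2 * r) * (\<Sum>j\<in>UNIV. \<Sum>k\<in>UNIV. x $ j * pd k (A j k) x - x $ k * pd j (A j k) x)"
      using R x by (simp add: sum_distrib_left sum_distrib_right mult.commute)
  qed (use R in simp)
  also have "\<dots> = 0"
  proof -
    have "continuous_on (exterior R) (\<lambda>x. x $ j * pd k (A j k) x - x $ k * pd j (A j k) x)" for j k
      using A[of j k] by (auto simp: C_on_1 intro!: continuous_intros)
    then show ?thesis
      by (subst round_integral_cmult) (simp add: round_integral_sum[OF _ R] continuous_on_sum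
          round_integral_rotation[OF A R])
  qed
  finally show ?thesis .
qed

text \<open>
  The divergence theorem in differential form. Differentiating \<open>r\<^sup>2 V(r \<omega>) \<sqdot> \<omega>\<close> under the integral
  produces only radial derivatives of \<open>V\<close>; the missing tangential ones are supplied by the rotations,
  because \<open>\<Sum> (x\<^sub>i \<partial>\<^sub>j - x\<^sub>j \<partial>\<^sub>i) (x\<^sub>i V\<^sub>j) = r\<^sup>2 div V - \<Sum> x\<^sub>i x\<^sub>j \<partial>\<^sub>i V\<^sub>j - 2 x \<sqdot> V\<close>.
\<close>

lemma has_real_derivative_round_flux:
  fixes V :: "3 \<Rightarrow> R3 \<Rightarrow> real"
  assumes V: "\<And>j. C_on 1 (V j) (exterior R)" and R: "0 \<le> R" "R < r"
  shows "((\<lambda>r. round_integral r (\<lambda>x. \<Sum>j\<in>UNIV. V j x * (x $ j / norm x))) has_real_derivative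
      round_integral r (\<lambda>x. \<Sum>j\<in>UNIV. pd j (V j) x)) (at r)"
proof -
  define \<omega> where "\<omega> z = sphere_param 1 (fst z) (snd z)" for z
  define \<Phi> where "\<Phi> s z = (\<Sum>j\<in>UNIV. V j (s *\<^sub>R \<omega> z) * \<omega> z $ j) * (s\<^sup>2 * sin (fst z))" for s z
  define \<Phi>' where "\<Phi>' s z = (\<Sum>j\<in>UNIV. (\<Sum>i\<in>UNIV. \<omega> z $ i * pd i (V j) (s *\<^sub>R \<omega> z)) * \<omega> z $ j) * (s\<^sup>2
      * sin (fst z))
      + (\<Sum>j\<in>UNIV. V j (s *\<^sub>R \<omega> z) * \<omega> z $ j) * (2 * s * sin (fst z))" for s z
  define E where "E x = (\<Sum>j\<in>UNIV. \<Sum>i\<in>UNIV. x $ i * x $ j * pd i (V j) x) + 2 * (\<Sum>j\<in>UNIV. x $ j * V j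
      x)" for x
  have ext: "s *\<^sub>R \<omega> z \<in> exterior R" if "s \<in> {R<..}" for s z
    using that R by (simp add: exterior_def \<omega>_def)
  have c\<omega>: "continuous_on T (\<lambda>w. \<omega> (a w))" if "continuous_on T a"
    for T :: "(real \<times> real \<times> real) set" and a
    unfolding \<omega>_def by (intro continuous_intros that)
  have cpoint: "continuous_on ({R<..} \<times> T) (\<lambda>w. fst w *\<^sub>R \<omega> (snd w))" for T
    by (intro continuous_on_scaleR c\<omega> continuous_intros)
  have cV: "continuous_on ({R<..} \<times> T) (\<lambda>w. V j (fst w *\<^sub>R \<omega> (snd w)))" for j T
    by (rule continuous_on_compose2[OF C_on_continuous[OF V] cpoint]) (use ext in auto)
  have cpd: "continuous_on ({R<..} \<times> T) (\<lambda>w. pd i (V j) (fst w *\<^sub>R \<omega> (snd w)))" for i j T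
  proof -
    have "continuous_on (exterior R) (pd i (V j))"
      using V[of j] unfolding C_on_1 by blast
    then show ?thesis
      by (rule continuous_on_compose2[OF _ cpoint]) (use ext in auto)
  qed
  have flux: "round_integral s (\<lambda>x. \<Sum>j\<in>UNIV. V j x * (x $ j / norm x)) = integral angles (\<Phi> s)"
    if "s \<in> {R<..}" for s
    unfolding round_integral_def using that R
    by (intro integral_cong)
      (auto simp: \<Phi>_def \<omega>_def sphere_param_scale[of s] sum_distrib_left sum_distrib_right)
  have D: "((\<lambda>s. \<Phi> s z) has_real_derivative \<Phi>' s z) (at s within {R<..})" if "s \<in> {R<..}" for s z
  proof -
    have "((\<lambda>s. V j (s *\<^sub>R \<omega> z)) has_real_derivative (\<Sum>i\<in>UNIV. \<omega> z $ i * pd i (V j) (s *\<^sub>R \<omega> z)))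
        (at s within {R<..})" for j
      unfolding has_real_derivative_iff_has_vector_derivative
      by (rule has_vector_derivative_along)
         (use C1_differentiable[OF V ext[OF that]] in \<open>auto intro!: derivative_eq_intros\<close>)
    then show ?thesis
      unfolding \<Phi>_def \<Phi>'_def
      by (auto intro!: derivative_eq_intros)
  qed
  have c\<Phi>_joint: "continuous_on ({R<..} \<times> T) (\<lambda>w. \<Phi> (fst w) (snd w))" for T
    unfolding \<Phi>_def by (intro continuous_intros cV c\<omega>)
  have c\<Phi>: "continuous_on T (\<Phi> s)" if "s \<in> {R<..}" for s T
    using continuous_on_compose2[OF c\<Phi>_joint, of T "\<lambda>z. (s, z)" T] that
    by (simp add: continuous_on_Pair image_subset_iff)
  have c\<Phi>': "continuous_on ({R<..} \<times> cbox (0, 0) (pi, 2 * pi)) (\<lambda>(s, z). \<Phi>' s z)"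
    unfolding \<Phi>'_def split_beta by (intro continuous_intros cV cpd c\<omega>)
  have "((\<lambda>s. integral angles (\<Phi> s)) has_real_derivative integral angles (\<Phi>' r)) (at r within {R<..})"
    unfolding angles_cbox
    by (rule leibniz_rule_field_derivative[OF D _ c\<Phi>']) (use R in \<open>auto intro!:
        integrable_continuous c\<Phi>\<close>)
  then have "((\<lambda>s. integral angles (\<Phi> s)) has_real_derivative integral angles (\<Phi>' r)) (at r)"
    using R by (simp add: at_within_open[of r "{R<..}"])
  then have *: "((\<lambda>s. round_integral s (\<lambda>x. \<Sum>j\<in>UNIV. V j x * (x $ j / norm x))) has_real_derivative
      integral angles (\<Phi>' r)) (at r)"
    using has_field_derivative_transform_within_open[of "\<lambda>s. integral angles (\<Phi> s)" _ r "{R<..}"]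
        flux R by auto
  have "integral angles (\<Phi>' r) = round_integral r (\<lambda>x. 1 / r\<^sup>2 * E x)"
    unfolding round_integral_def using R
    by (intro integral_cong)
      (auto simp: \<Phi>'_def E_def \<omega>_def sphere_param_scale[of r] sum_distrib_left sum_distrib_right
        power2_eq_square algebra_simps)
  also have "\<dots> = 1 / r\<^sup>2 * round_integral r E"
    by (rule round_integral_cmult)
  also have "round_integral r E = round_integral r (\<lambda>x. r\<^sup>2 * (\<Sum>j\<in>UNIV. pd j (V j) x))"
  proof -
    let ?rot = "\<lambda>i j x. x $ i * pd j (\<lambda>x. x $ i * V j x) x - x $ j * pd i (\<lambda>x. x $ i * V j x) x"
    have C: "C_on 1 (\<lambda>x. x $ i * V j x) (exterior R)" for i j
      by (intro C1_intros V)
    have cont: "continuous_on (exterior R) (?rot i j)" for i j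
      using C[of i j] by (auto simp: C_on_1 intro!: continuous_intros)
    have cont': "continuous_on (exterior R) E"
      unfolding E_def using V C_on_continuous[OF V] by (auto simp: C_on_1 intro!: continuous_intros)
    have "round_integral r (\<lambda>x. r\<^sup>2 * (\<Sum>j\<in>UNIV. pd j (V j) x))
        = round_integral r (\<lambda>x. E x + (\<Sum>i\<in>UNIV. \<Sum>j\<in>UNIV. ?rot i j x))"
    proof (rule round_integral_cong)
      fix x :: R3 assume x: "norm x = r"
      then have "x \<in> exterior R" using R by (simp add: exterior_def)
      then have pdx: "pd k (\<lambda>x. x $ i * V j x) x = (if k = i then 1 else 0) * V j x + x $ i * pd k
          (V j) x" for k i j
        by (subst pd_mult) (auto simp: pd_coord intro!: C1_differentiable[OF V] C1_differentiable[OF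
            C1_coord])
      have "r\<^sup>2 = x $ 1 * x $ 1 + x $ 2 * x $ 2 + x $ 3 * x $ 3"
        unfolding x[symmetric] power2_norm_eq_inner by (simp add: inner_vec_def sum_3)
      then show "r\<^sup>2 * (\<Sum>j\<in>UNIV. pd j (V j) x) = E x + (\<Sum>i\<in>UNIV. \<Sum>j\<in>UNIV. ?rot i j x)"
        unfolding pdx E_def by (simp add: sum_3 algebra_simps)
    qed (use R in simp)
    also have "\<dots> = round_integral r E + round_integral r (\<lambda>x. \<Sum>i\<in>UNIV. \<Sum>j\<in>UNIV. ?rot i j x)"
      by (rule round_integral_add[OF cont' _ R]) (intro continuous_on_sum cont)
    also have "round_integral r (\<lambda>x. \<Sum>i\<in>UNIV. \<Sum>j\<in>UNIV. ?rot i j x) = 0"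
      by (subst round_integral_sum[OF _ R], intro continuous_on_sum cont,
          subst round_integral_sum[OF _ R], intro cont, simp only: round_integral_rotation[OF C R])
         simp
    finally show ?thesis
      by simp
  qed
  also have "1 / r\<^sup>2 * \<dots> = round_integral r (\<lambda>x. \<Sum>j\<in>UNIV. pd j (V j) x)"
    using R by (simp add: round_integral_cmult)
  finally show ?thesis
    using * by simp
qed

section \<open>Cofactors of a 3 x 3 matrix\<close>

lemma index3_cycle [simp]: "(4::3) = 1" "(5::3) = 2"
  by simp_all

text \<open>
  Arithmetic in the index type \<open>3\<close> is modulo 3, so cyclic indices give the signed cofactors without
  signs or case distinctions.
\<close>

definition cof3 :: "mat3 \<Rightarrow> 3 \<Rightarrow> 3 \<Rightarrow> real" where
  "cof3 A i j = A $ (i + 1) $ (j + 1) * A $ (i + 2) $ (j + 2)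
     - A $ (i + 1) $ (j + 2) * A $ (i + 2) $ (j + 1)"

lemma cof3_row: "(\<Sum>k\<in>UNIV. A $ i $ k * cof3 A j k) = (if i = j then det A else 0)"
  using exhaust_3[of i] exhaust_3[of j]
  by (auto simp: cof3_def sum_3 det_3 algebra_simps)

lemma cof3_mat_1: "cof3 (mat 1) i j = mat 1 $ i $ j"
  using exhaust_3[of i] exhaust_3[of j] by (auto simp: cof3_def mat_def)

lemma matrix_inv_nth:
  assumes "det A \<noteq> 0"
  shows "matrix_inv A $ i $ j = cof3 A j i / det (A :: mat3)"
proof -
  define B :: mat3 where "B = (\<chi> i j. cof3 A j i / det A)"
  have "(\<Sum>k\<in>UNIV. A $ i $ k * (cof3 A j k / det A)) = (if i = j then 1 else 0)" for i j
    using cof3_row[of A i j] assms by (simp add: sum_divide_distrib[symmetric])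
  then have "A ** B = mat 1"
    by (simp add: B_def matrix_matrix_mult_def mat_def vec_eq_iff)
  then have "B ** A = mat 1"
    by (simp add: matrix_left_right_inverse)
  with \<open>A ** B = mat 1\<close> have "A ** matrix_inv A = mat 1"
    unfolding matrix_inv_def by (rule_tac someI2[of _ B]) auto
  then have "matrix_inv A = B"
    by (metis \<open>B ** A = mat 1\<close> matrix_mul_assoc matrix_mul_lid matrix_mul_rid)
  then show ?thesis
    by (simp add: B_def)
qed

lemma quadratic_form_nth: "(u::R3) \<bullet> (A *v v) = (\<Sum>i\<in>UNIV. \<Sum>j\<in>UNIV. A $ i $ j * u $ i * v $ j)"
  by (simp add: inner_vec_def matrix_vector_mult_def sum_distrib_left mult_ac)

context
  fixes A :: mat3
  assumes sym: "\<And>i j. A $ i $ j = A $ j $ i"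
    and pos: "\<And>v. v \<noteq> 0 \<Longrightarrow> v \<bullet> (A *v v) > 0"
begin

lemma cof3_vector:
  fixes x :: R3
  defines "y \<equiv> \<chi> k. \<Sum>j\<in>UNIV. cof3 A j k * x $ j"
  shows "A *v y = det A *\<^sub>R x"
proof -
  have "(\<Sum>k\<in>UNIV. A $ i $ k * (\<Sum>j\<in>UNIV. cof3 A j k * x $ j)) = det A * x $ i" for i
  proof -
    have "(\<Sum>k\<in>UNIV. A $ i $ k * (\<Sum>j\<in>UNIV. cof3 A j k * x $ j))
        = (\<Sum>j\<in>UNIV. (\<Sum>k\<in>UNIV. A $ i $ k * cof3 A j k) * x $ j)"
      by (subst sum_distrib_right, subst sum.swap) (simp add: sum_distrib_left mult_ac)
    also have "\<dots> = det A * x $ i"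
      by (simp add: cof3_row if_distrib[of "\<lambda>a. a * _"] cong: if_cong)
    finally show ?thesis .
  qed
  then show ?thesis
    by (simp add: y_def vec_eq_iff matrix_vector_mult_def)
qed

text \<open>
  The third row \<open>y\<close> of cofactors satisfies \<open>A y = det A e\<^sub>3\<close>, hence \<open>0 < y \<sqdot> A y = det A \<sqdot> y\<^sub>3\<close>.
  Here \<open>y\<^sub>3\<close> is a two by two principal minor, positive by testing \<open>A\<close> on a vector of the first two axes.
\<close>

lemma det_pos: "det A > 0"
proof -
  have A11: "A $ 1 $ 1 > 0"
    using pos[of "axis 1 1"] by (simp add: quadratic_form_nth sum_3 axis_def vec_eq_iff forall_3)
  let ?u = "vector [- A $ 1 $ 2, A $ 1 $ 1, 0] :: R3"
  have "?u \<noteq> 0"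
    using A11 by (simp add: vec_eq_iff forall_3)
  from pos[OF this] have "A $ 1 $ 1 * (A $ 1 $ 1 * A $ 2 $ 2 - A $ 1 $ 2 * A $ 2 $ 1) > 0"
    using sym[of 2 1] by (simp add: quadratic_form_nth sum_3 algebra_simps)
  then have c33: "cof3 A 3 3 > 0"
    using A11 by (simp add: cof3_def zero_less_mult_iff)
  let ?y = "\<chi> k. \<Sum>j\<in>UNIV. cof3 A j k * (axis 3 1 :: R3) $ j"
  have y: "?y = (\<chi> k. cof3 A 3 k)"
    by (simp add: axis_def sum_3 vec_eq_iff)
  have "?y \<noteq> 0"
    unfolding y vec_eq_iff using c33 by (auto intro!: exI[of _ 3])
  from pos[OF this] have "?y \<bullet> (det A *\<^sub>R axis 3 1) > 0"
    by (simp add: cof3_vector)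
  then have "det A * cof3 A 3 3 > 0"
    by (simp add: y inner_axis mult.commute)
  then show ?thesis
    using c33 by (simp add: zero_less_mult_iff)
qed

lemma cof3_sym: "cof3 A i j = cof3 A j i"
  by (simp add: cof3_def sym[of "j + 1"] sym[of "j + 2"] mult.commute)

lemma cof3_form_pos:
  fixes x :: R3
  assumes "x \<noteq> 0"
  shows "(\<Sum>i\<in>UNIV. \<Sum>j\<in>UNIV. cof3 A i j * x $ i * x $ j) > 0"
proof -
  let ?y = "\<chi> k. \<Sum>j\<in>UNIV. cof3 A j k * x $ j"
  have "?y \<noteq> 0"
    using cof3_vector[of x] det_pos assms by (metis matrix_vector_mult_0_right order_less_irrefl
        scaleR_eq_0_iff)
  from pos[OF this] have "det A * (?y \<bullet> x) > 0"
    by (simp add: cof3_vector)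
  then have "?y \<bullet> x > 0"
    using det_pos by (simp add: zero_less_mult_iff)
  then show ?thesis
    by (subst sum.swap) (simp add: inner_vec_def sum_distrib_left mult_ac)
qed

text \<open>
  The squared area of the parallelogram spanned by \<open>u\<close> and \<open>v\<close> with respect to \<open>A\<close>, in terms of the
  cross product \<open>w = u \<times> v\<close>: the cofactor matrix is the metric that \<open>A\<close> induces on bivectors.
\<close>

lemma gram_cof3:
  fixes u v w :: R3
  assumes "w $ 1 = u $ 2 * v $ 3 - u $ 3 * v $ 2" "w $ 2 = u $ 3 * v $ 1 - u $ 1 * v $ 3"
    "w $ 3 = u $ 1 * v $ 2 - u $ 2 * v $ 1"
  shows "(u \<bullet> (A *v u)) * (v \<bullet> (A *v v)) - (u \<bullet> (A *v v))\<^sup>2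
    = (\<Sum>i\<in>UNIV. \<Sum>j\<in>UNIV. cof3 A i j * w $ i * w $ j)"
proof -
  have "A $ 2 $ 1 = A $ 1 $ 2" "A $ 3 $ 1 = A $ 1 $ 3" "A $ 3 $ 2 = A $ 2 $ 3"
    by (rule sym)+
  then show ?thesis
    unfolding quadratic_form_nth
    by (simp add: sum_3 cof3_def assms power2_eq_square algebra_simps)
qed

end

text \<open>
  The vector-valued area form \<open>\<nu>\<^sub>g d\<sigma>\<^sub>g\<close> is linear in the Euclidean one, with matrix
  \<open>sqrt (det g) g\<^sup>-\<^sup>1 = cof g / sqrt (det g)\<close>: the square roots in the area density and in the
  normalization of the normal cancel.
\<close>

lemma density_times_normal:
  assumes sym: "\<And>i j. G x $ i $ j = G x $ j $ i"
    and pos: "\<And>v. v \<noteq> 0 \<Longrightarrow> v \<bullet> (G x *v v) > 0"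
    and x: "x = sphere_param r \<theta> \<phi>" and "r > 0" "sin \<theta> \<ge> 0"
  shows "unit_normal G x $ j * area_density G r \<theta> \<phi>
    = (\<Sum>k\<in>UNIV. cof3 (G x) j k / sqrt (det (G x)) * (x $ k / norm x)) * (r\<^sup>2 * sin \<theta>)"
proof -
  define Q where "Q = (\<Sum>i\<in>UNIV. \<Sum>j\<in>UNIV. cof3 (G x) i j * x $ i * x $ j)"
  have det: "det (G x) > 0"
    by (rule det_pos) (use sym pos in auto)
  have cof_sym: "cof3 (G x) i j = cof3 (G x) j i" for i j
    by (rule cof3_sym) (use sym pos in auto)
  have "norm x = r" using x \<open>r > 0\<close> by simp
  then have "x \<noteq> 0" using \<open>r > 0\<close> by auto
  then have "Q > 0"
    unfolding Q_def by (rule cof3_form_pos[rotated 2]) (use sym pos in auto)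
  have area: "area_density G r \<theta> \<phi> = r * sin \<theta> * sqrt Q"
  proof -
    define u :: R3 where "u = vector [r * cos \<theta> * cos \<phi>, r * cos \<theta> * sin \<phi>, - r * sin \<theta>]"
    define v :: R3 where "v = vector [- r * sin \<theta> * sin \<phi>, r * sin \<theta> * cos \<phi>, 0]"
    define w :: R3 where "w = (r * sin \<theta>) *\<^sub>R x"
    have "u $ 1 * v $ 2 - u $ 2 * v $ 1 = r * sin \<theta> * (r * cos \<theta>) * ((cos \<phi>)\<^sup>2 + (sin \<phi>)\<^sup>2)"
      unfolding u_def v_def vector_3 by algebra
    then have w3: "w $ 3 = u $ 1 * v $ 2 - u $ 2 * v $ 1"
      by (simp add: w_def x)
    have w12: "w $ 1 = u $ 2 * v $ 3 - u $ 3 * v $ 2" "w $ 2 = u $ 3 * v $ 1 - u $ 1 * v $ 3"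
      by (simp_all add: u_def v_def w_def x)
    have "(u \<bullet> (G x *v u)) * (v \<bullet> (G x *v v)) - (u \<bullet> (G x *v v))\<^sup>2
        = (\<Sum>i\<in>UNIV. \<Sum>j\<in>UNIV. cof3 (G x) i j * w $ i * w $ j)"
      by (rule gram_cof3) (use sym pos w12 w3 in auto)
    also have "\<dots> = (r * sin \<theta>)\<^sup>2 * Q"
      by (simp add: Q_def w_def sum_distrib_left power2_eq_square mult_ac)
    finally have "area_density G r \<theta> \<phi> = sqrt ((r * sin \<theta>)\<^sup>2 * Q)"
      unfolding area_density_def Let_def x[symmetric] u_def v_def
        vector_derivative_at[OF has_vector_derivative_sphere_param_theta]
        vector_derivative_at[OF has_vector_derivative_sphere_param_phi]
      by simp
    also have "\<dots> = r * sin \<theta> * sqrt Q"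
      using \<open>r > 0\<close> \<open>sin \<theta> \<ge> 0\<close> by (simp add: real_sqrt_mult)
    finally show ?thesis .
  qed
  have inv: "ginv G x $ i $ j = cof3 (G x) i j / det (G x)" for i j
    using det by (simp add: ginv_def matrix_inv_nth cof_sym[of i j])
  have form: "x \<bullet> (ginv G x *v x) = Q / det (G x)"
    by (simp add: quadratic_form_nth inv Q_def sum_divide_distrib)
  have "unit_normal G x $ j = (\<Sum>k\<in>UNIV. cof3 (G x) j k * x $ k) / (det (G x) * sqrt (Q / det (G x)))"
    unfolding unit_normal_def form by (simp add: matrix_vector_mult_def inv sum_divide_distrib)
  also have "det (G x) * sqrt (Q / det (G x)) = sqrt (det (G x)) * sqrt Q"
    using det by (simp add: real_sqrt_divide field_simps)
  finally have "unit_normal G x $ j * area_density G r \<theta> \<phi>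
      = (\<Sum>k\<in>UNIV. cof3 (G x) j k * x $ k) / sqrt (det (G x)) * (r * sin \<theta>)"
    using \<open>Q > 0\<close> by (simp add: area)
  then show ?thesis
    using \<open>norm x = r\<close> \<open>r > 0\<close>
    by (simp add: sum_divide_distrib sum_distrib_right power2_eq_square mult.assoc)
qed

section \<open>Curvature of a Regge--Teitelboim end\<close>

text \<open>
  The properties of the metric components in the asymptotic chart on which the comparison of the
  fluxes rests.
\<close>

locale rt_metric =
  fixes G :: "R3 \<Rightarrow> mat3" and R \<delta> :: real
  assumes R: "0 \<le> R" and \<delta>: "1 / 2 < \<delta>"
    and sym: "x \<in> exterior R \<Longrightarrow> G x $ i $ j = G x $ j $ i"
    and pos: "x \<in> exterior R \<Longrightarrow> v \<noteq> 0 \<Longrightarrow> v \<bullet> (G x *v v) > 0"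
    and C2: "C_on 2 (\<lambda>x. G x $ i $ j) (exterior R)"
    and G_decay: "parity_decay R 1 \<delta> (\<lambda>x. G x $ i $ j - mat 1 $ i $ j)"
    and dG_decay: "parity_decay R (-1) (1 + \<delta>) (pd k (\<lambda>x. G x $ i $ j))"
    and ddG_decay: "parity_decay R 1 (2 + \<delta>) (pd l (pd k (\<lambda>x. G x $ i $ j)))"
begin

abbreviation S where "S \<equiv> exterior R"

abbreviation dG :: "3 \<Rightarrow> 3 \<Rightarrow> 3 \<Rightarrow> R3 \<Rightarrow> real" where
  "dG k i j \<equiv> pd k (\<lambda>x. G x $ i $ j)"

lemma G_C1: "C_on 1 (\<lambda>x. G x $ i $ j) S"
  using C2 by (rule C_on_mono) simp

lemma dG_C1: "C_on 1 (dG k i j) S"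
  using C2[of i j] by (auto simp: numeral_2_eq_2)

lemma dG_sym: "x \<in> S \<Longrightarrow> dG k i j x = dG k j i x"
  by (rule pd_cong[OF open_exterior]) (auto intro: sym)

lemma ddG_sym: "x \<in> S \<Longrightarrow> pd l (dG k i j) x = pd l (dG k j i) x"
  by (rule pd_cong[OF open_exterior]) (auto intro: dG_sym)

lemma ddG_commute: "x \<in> S \<Longrightarrow> pd l (dG k i j) x = pd k (dG l i j) x"
  by (rule pd_pd_commute[OF open_exterior C2])

lemma det_G_pos: "x \<in> S \<Longrightarrow> det (G x) > 0"
  by (rule det_pos) (auto intro: sym pos)

text \<open>Functions that behave like the components of \<open>G\<close>: bounded and asymptotically even, with
  derivatives that decay one order faster and are asymptotically odd.\<close>

definition metric_like :: "(R3 \<Rightarrow> real) \<Rightarrow> bool" where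
  "metric_like f \<longleftrightarrow> C_on 1 f S \<and> parity_decay R 1 0 f \<and>
     (\<forall>m. parity_decay R (-1) (1 + \<delta>) (pd m f))"

lemma metric_like_C1: "metric_like f \<Longrightarrow> C_on 1 f S"
  and metric_like_decay: "metric_like f \<Longrightarrow> parity_decay R 1 0 f"
  and metric_like_pd: "metric_like f \<Longrightarrow> parity_decay R (-1) (1 + \<delta>) (pd m f)"
  by (simp_all add: metric_like_def)

lemma metric_like_differentiable: "metric_like f \<Longrightarrow> x \<in> S \<Longrightarrow> f differentiable (at x)"
  using metric_like_C1 C1_differentiable by blast

lemma metric_like_cong:
  assumes "metric_like f" "\<And>x. x \<in> S \<Longrightarrow> f x = g x"
  shows "metric_like g"
proof -
  have pd: "pd m f x = pd m g x" if "x \<in> S" for m x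
    by (rule pd_cong[OF open_exterior that assms(2)])
  have "C_on 1 g S"
    by (rule C_on_cong_open[OF open_exterior assms(2) metric_like_C1[OF assms(1)]])
  moreover have "parity_decay R 1 0 g"
    using metric_like_decay[OF assms(1)] assms(2) by (rule parity_decay_cong)
  moreover have "parity_decay R (-1) (1 + \<delta>) (pd m g)" for m
    using metric_like_pd[OF assms(1)] pd by (rule parity_decay_cong)
  ultimately show ?thesis
    by (simp add: metric_like_def)
qed

lemma metric_like_G: "metric_like (\<lambda>x. G x $ i $ j)"
proof -
  have "parity_decay R 1 0 (\<lambda>x. (G x $ i $ j - mat 1 $ i $ j) + mat 1 $ i $ j)"
    using \<delta> by (intro parity_decay_add parity_decay_const parity_decay_mono[OF G_decay]) auto
  then show ?thesis
    using G_C1 dG_decay by (simp add: metric_like_def)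
qed

lemma metric_like_diff:
  assumes "metric_like f" "metric_like g"
  shows "metric_like (\<lambda>x. f x - g x)"
proof -
  have "parity_decay R (-1) (1 + \<delta>) (pd m (\<lambda>x. f x - g x))" for m
    by (rule parity_decay_cong[OF parity_decay_diff[OF assms[THEN metric_like_pd]]])
       (simp add: pd_diff metric_like_differentiable assms)
  then show ?thesis
    using assms by (auto simp: metric_like_def intro: C1_diff parity_decay_diff simp del: One_nat_def)
qed

lemma metric_like_add:
  assumes "metric_like f" "metric_like g"
  shows "metric_like (\<lambda>x. f x + g x)"
proof -
  have "parity_decay R (-1) (1 + \<delta>) (pd m (\<lambda>x. f x + g x))" for m
    by (rule parity_decay_cong[OF parity_decay_add[OF assms[THEN metric_like_pd]]])
       (simp add: pd_add metric_like_differentiable assms)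
  then show ?thesis
    using assms by (auto simp: metric_like_def intro: C1_add parity_decay_add simp del: One_nat_def)
qed

lemma metric_like_mult:
  assumes f: "metric_like f" and g: "metric_like g"
  shows "metric_like (\<lambda>x. f x * g x)"
proof -
  have "parity_decay R (-1) (1 + \<delta>) (\<lambda>x. pd m f x * g x + f x * pd m g x)" for m
    using metric_like_decay[OF f] metric_like_decay[OF g] metric_like_pd[OF f] metric_like_pd[OF g]
    by (intro parity_decay_add parity_decay_mult[of R "-1" "1 + \<delta>" _ 1 0]
        parity_decay_mult[of R 1 0 _ "-1" "1 + \<delta>"]) auto
  then have "parity_decay R (-1) (1 + \<delta>) (pd m (\<lambda>x. f x * g x))" for m
    by (rule parity_decay_cong) (simp add: pd_mult metric_like_differentiable f g)
  moreover have "parity_decay R 1 0 (\<lambda>x. f x * g x)"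
    using metric_like_decay[OF f] metric_like_decay[OF g] by (rule parity_decay_mult) auto
  ultimately show ?thesis
    using C1_mult[OF metric_like_C1[OF f] metric_like_C1[OF g]] by (simp add: metric_like_def)
qed

lemma metric_like_cof3: "metric_like (\<lambda>x. cof3 (G x) i j)"
  unfolding cof3_def by (intro metric_like_diff metric_like_mult metric_like_G)

lemma det_eq_cof3: "det A = A $ 1 $ 1 * cof3 A 1 1 + A $ 1 $ 2 * cof3 A 1 2 + A $ 1 $ 3 * cof3 A 1 3"
  using cof3_row[of A 1 1] by (simp add: sum_3)

lemma metric_like_det: "metric_like (\<lambda>x. det (G x))"
  unfolding det_eq_cof3 by (intro metric_like_add metric_like_mult metric_like_G metric_like_cof3)

lemma product_decay_to_limit:
  assumes f: "metric_like f" "parity_decay R 1 \<delta> (\<lambda>x. f x - a)"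
    and g: "metric_like g" "parity_decay R 1 \<delta> (\<lambda>x. g x - b)"
  shows "parity_decay R 1 \<delta> (\<lambda>x. f x * g x - a * b)"
proof -
  have "parity_decay R 1 \<delta> (\<lambda>x. (f x - a) * g x + a * (g x - b))"
    using parity_decay_mult[OF f(2) metric_like_decay[OF g(1)], of 1 \<delta>]
    by (intro parity_decay_add parity_decay_cmult g) auto
  then show ?thesis
    by (simp add: algebra_simps)
qed

lemma cof3_decay: "parity_decay R 1 \<delta> (\<lambda>x. cof3 (G x) i j - mat 1 $ i $ j)"
proof -
  have "parity_decay R 1 \<delta> (\<lambda>x. (G x $ (i + 1) $ (j + 1) * G x $ (i + 2) $ (j + 2)
        - mat 1 $ (i + 1) $ (j + 1) * mat 1 $ (i + 2) $ (j + 2))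
      - (G x $ (i + 1) $ (j + 2) * G x $ (i + 2) $ (j + 1)
        - mat 1 $ (i + 1) $ (j + 2) * mat 1 $ (i + 2) $ (j + 1)))"
    by (intro parity_decay_diff product_decay_to_limit metric_like_G G_decay)
  then show ?thesis
    by (rule parity_decay_cong) (use cof3_mat_1[of i j] in \<open>simp add: cof3_def\<close>)
qed

lemma det_decay: "parity_decay R 1 \<delta> (\<lambda>x. det (G x) - 1)"
proof -
  let ?p = "\<lambda>k x. G x $ 1 $ k * cof3 (G x) 1 k - mat 1 $ 1 $ k * mat 1 $ 1 $ k"
  have "parity_decay R 1 \<delta> (\<lambda>x. ?p 1 x + ?p 2 x + ?p 3 x)"
    by (intro parity_decay_add product_decay_to_limit metric_like_G G_decay metric_like_cof3 cof3_decay)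
  then show ?thesis
    by (simp add: det_eq_cof3 mat_def algebra_simps)
qed

lemma continuous_det_image: 
  assumes "\<And>u. u > 0 \<Longrightarrow> isCont \<phi> u"
  shows "continuous_on ((\<lambda>x. det (G x)) ` S) (\<phi> :: real \<Rightarrow> real)"
  using assms det_G_pos by (auto intro!: continuous_at_imp_continuous_on)

lemma inverse_det_decay: "parity_decay R 1 \<delta> (\<lambda>x. inverse (det (G x)) - 1)"
proof -
  have "parity_decay R 1 \<delta> (\<lambda>x. inverse (det (G x)) - inverse 1)"
  proof (rule parity_decay_compose_lipschitz[OF det_decay, where d = "1/2" and L = 4])
    fix u v :: real assume "\<bar>u - 1\<bar> < 1 / 2" "\<bar>v - 1\<bar> < 1 / 2"
    then have uv: "u > 1/2" "v > 1/2" by linarith+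
    then have "1/2 * (1/2) \<le> u * v" by (intro mult_mono) auto
    then have "\<bar>u - v\<bar> \<le> 4 * \<bar>u - v\<bar> * (u * v)"
      using mult_left_mono[of "1/4" "u * v" "4 * \<bar>u - v\<bar>"] by simp
    moreover have "\<bar>inverse u - inverse v\<bar> = \<bar>u - v\<bar> / (u * v)"
      using uv by (simp add: divide_simps abs_if)
    ultimately show "\<bar>inverse u - inverse v\<bar> \<le> 4 * \<bar>u - v\<bar>"
      using uv by (simp add: divide_simps)
  qed (use \<delta> in \<open>auto intro!: continuous_det_image continuous_intros\<close>)
  then show ?thesis by simp
qed

lemma inverse_sqrt_det_decay: "parity_decay R 1 \<delta> (\<lambda>x. inverse (sqrt (det (G x))) - 1)"
proof -
  have "parity_decay R 1 \<delta> (\<lambda>x. inverse (sqrt (det (G x))) - inverse (sqrt 1))"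
  proof (rule parity_decay_compose_lipschitz[OF det_decay, where d = "3/4" and L = 4])
    fix u v :: real assume "\<bar>u - 1\<bar> < 3 / 4" "\<bar>v - 1\<bar> < 3 / 4"
    then have uv: "u > 1/4" "v > 1/4" by linarith+
    define a b where "a = sqrt u" and "b = sqrt v"
    have ab: "a > 1/2" "b > 1/2" "u = a\<^sup>2" "v = b\<^sup>2"
      using uv real_less_rsqrt[of "1/2"] by (auto simp: a_def b_def power2_eq_square)
    then have "1/2 * (1/2) \<le> a * b" by (intro mult_mono) auto
    then have "(1/4) * 1 \<le> (a * b) * (a + b)" using ab by (intro mult_mono) auto
    then have "\<bar>a - b\<bar> \<le> 4 * \<bar>a - b\<bar> * ((a * b) * (a + b))"
      using mult_left_mono[of "1/4" "(a * b) * (a + b)" "4 * \<bar>a - b\<bar>"] by simp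
    moreover have "\<bar>u - v\<bar> = \<bar>a - b\<bar> * (a + b)"
      using ab by (simp add: power2_eq_square square_diff_square_factored abs_mult)
    ultimately have "\<bar>a - b\<bar> \<le> 4 * \<bar>u - v\<bar> * (a * b)"
      by (simp add: algebra_simps)
    moreover have "\<bar>inverse a - inverse b\<bar> = \<bar>a - b\<bar> / (a * b)"
      using ab by (simp add: divide_simps abs_if)
    ultimately show "\<bar>inverse (sqrt u) - inverse (sqrt v)\<bar> \<le> 4 * \<bar>u - v\<bar>"
      using ab unfolding a_def[symmetric] b_def[symmetric] by (simp add: divide_simps)
  qed (use \<delta> in \<open>auto intro!: continuous_det_image continuous_intros\<close>)
  then show ?thesis by simp
qed

lemma metric_like_inverse_det: "metric_like (\<lambda>x. inverse (det (G x)))"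
proof -
  let ?f = "\<lambda>x. det (G x)" and ?i = "\<lambda>x. inverse (det (G x))"
  have i: "parity_decay R 1 0 ?i"
    using parity_decay_add[OF parity_decay_mono[OF inverse_det_decay] parity_decay_const[of R 1]] \<delta>
    by simp
  have pd_i: "pd m ?i x = - (?i x * pd m ?f x * ?i x)" if "x \<in> S" for m x
    using det_G_pos[OF that] by (intro pd_inverse metric_like_differentiable metric_like_det that) auto
  have "parity_decay R (-1) (1 + \<delta>) (\<lambda>x. - (?i x * pd m ?f x * ?i x))" for m
    by (intro parity_decay_uminus parity_decay_mult[OF parity_decay_mult[OF i
          metric_like_pd[OF metric_like_det], of "-1" "1 + \<delta>"] i]) auto
  then have pd: "parity_decay R (-1) (1 + \<delta>) (pd m ?i)" for m
    by (rule parity_decay_cong) (simp only: pd_i)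
  have "C_on 1 ?i S"
    unfolding C_on_1
  proof (intro conjI ballI allI)
    show "?i differentiable (at x)" if "x \<in> S" for x
      using metric_like_differentiable[OF metric_like_det that] det_G_pos[OF that]
      by (intro differentiable_inverse) auto
    show "continuous_on S (pd m ?i)" for m
      using pd by (rule parity_decay_continuous)
  qed
  with i pd show ?thesis
    by (simp add: metric_like_def)
qed

lemma ginv_nth: "x \<in> S \<Longrightarrow> ginv G x $ i $ j = cof3 (G x) j i * inverse (det (G x))"
  using det_G_pos[of x] by (simp add: ginv_def matrix_inv_nth field_simps)

lemma metric_like_ginv: "metric_like (\<lambda>x. ginv G x $ i $ j)"
  by (rule metric_like_cong[OF metric_like_mult[OF metric_like_cof3[of j i] metric_like_inverse_det]])
     (simp add: ginv_nth)

lemma ginv_decay: "parity_decay R 1 \<delta> (\<lambda>x. ginv G x $ i $ j - mat 1 $ i $ j)"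
proof -
  have "parity_decay R 1 \<delta> (\<lambda>x. cof3 (G x) j i * inverse (det (G x)) - mat 1 $ j $ i * 1)"
    by (intro product_decay_to_limit metric_like_cof3 cof3_decay metric_like_inverse_det
        inverse_det_decay)
  then show ?thesis
    by (rule parity_decay_cong) (auto simp: ginv_nth mat_def)
qed

subsection \<open>Curvature and its linearization\<close>

text \<open>Twice the Christoffel symbols of the first kind.\<close>

definition christoffel_first :: "3 \<Rightarrow> 3 \<Rightarrow> 3 \<Rightarrow> R3 \<Rightarrow> real" where
  "christoffel_first l i j x = dG i j l x + dG j i l x - dG l i j x"

lemma christoffel_first_C1: "C_on 1 (christoffel_first l i j) S"
  unfolding christoffel_first_def by (intro C1_add C1_diff dG_C1)

lemma christoffel_first_decay: "parity_decay R (-1) (1 + \<delta>) (christoffel_first l i j)"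
  unfolding christoffel_first_def by (intro parity_decay_add parity_decay_diff dG_decay)

lemma pd_christoffel_first: "x \<in> S \<Longrightarrow> pd m (christoffel_first l i j) x = pd m (dG i j l) x + pd m (dG
    j i l) x - pd m (dG l i j) x"
  unfolding christoffel_first_def
  by (simp add: pd_add pd_diff differentiable_add C1_differentiable[OF dG_C1])

lemma pd_christoffel_first_decay: "parity_decay R 1 (2 + \<delta>) (pd m (christoffel_first l i j))"
  by (rule parity_decay_cong[OF parity_decay_diff[OF parity_decay_add[OF ddG_decay ddG_decay]
      ddG_decay]])
     (simp only: pd_christoffel_first)

lemma christoffel_eq: "christoffel G k i j x = 1/2 * (\<Sum>l\<in>UNIV. ginv G x $ k $ l * christoffel_first
    l i j x)"
  by (simp add: christoffel_def christoffel_first_def)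

lemma christoffel_decay: "parity_decay R (-1) (1 + \<delta>) (christoffel G k i j)"
  unfolding christoffel_eq
  by (intro parity_decay_cmult parity_decay_sum
      parity_decay_mult[OF metric_like_decay[OF metric_like_ginv] christoffel_first_decay]) auto

lemma pd_christoffel:
  assumes "x \<in> S"
  shows "pd m (christoffel G k i j) x = 1/2 * (\<Sum>l\<in>UNIV.
    pd m (\<lambda>x. ginv G x $ k $ l) x * christoffel_first l i j x + ginv G x $ k $ l * pd m
        (christoffel_first l i j) x)"
proof -
  note diff = metric_like_differentiable[OF metric_like_ginv assms] C1_differentiable[OF
      christoffel_first_C1 assms]
  show ?thesis
    unfolding christoffel_eq
    by (subst pd_cmult) (auto simp: pd_sum pd_mult diff intro!: differentiable_sum
        differentiable_mult diff)
qed

lemma sum_mat_1: "(\<Sum>l\<in>UNIV. mat 1 $ k $ l * f l) = (f k :: real)"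
  by (simp add: mat_def if_distrib[of "\<lambda>a. a * _"] cong: if_cong)

text \<open>
  The error consists of the terms \<open>\<partial>g\<^sup>-\<^sup>1 \<partial>g\<close> and \<open>(g\<^sup>-\<^sup>1 - \<delta>) \<partial>\<partial>g\<close>: products of two odd or of two
  even factors, of total order \<open>2 + 2 \<delta>\<close>.
\<close>

lemma pd_christoffel_linear:
  "parity_decay R 1 (2 + 2 * \<delta>) (\<lambda>x. pd m (christoffel G k i j) x - 1/2 * pd m (christoffel_first k
      i j) x)"
proof (rule parity_decay_cong)
  show "parity_decay R 1 (2 + 2 * \<delta>) (\<lambda>x. 1/2 * (\<Sum>l\<in>UNIV.
      pd m (\<lambda>x. ginv G x $ k $ l) x * christoffel_first l i j x + (ginv G x $ k $ l - mat 1 $ k $ l)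
          * pd m (christoffel_first l i j) x))"
    by (intro parity_decay_cmult parity_decay_sum parity_decay_add
        parity_decay_mult[OF metric_like_pd[OF metric_like_ginv] christoffel_first_decay]
        parity_decay_mult[OF ginv_decay pd_christoffel_first_decay]) auto
qed (simp add: pd_christoffel left_diff_distrib sum_subtractf sum_mat_1 sum.distrib right_diff_distrib)

text \<open>The curvature formulas with the inverse metric replaced by \<open>\<delta>\<close> and the products of Christoffel
  symbols dropped.\<close>

definition linear_ricci :: "3 \<Rightarrow> 3 \<Rightarrow> R3 \<Rightarrow> real" where
  "linear_ricci i j x = (\<Sum>k\<in>UNIV. 1/2 * pd k (christoffel_first k i j) x - 1/2 * pd j
      (christoffel_first k i k) x)"

definition linear_scalar :: "R3 \<Rightarrow> real" where
  "linear_scalar x = (\<Sum>i\<in>UNIV. linear_ricci i i x)"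

lemma linear_ricci_decay: "parity_decay R 1 (2 + \<delta>) (linear_ricci i j)"
  unfolding linear_ricci_def by (intro parity_decay_sum parity_decay_diff parity_decay_cmult
      pd_christoffel_first_decay)

lemma ricci_linear: "parity_decay R 1 (2 + 2 * \<delta>) (\<lambda>x. ricci G i j x - linear_ricci i j x)"
proof -
  let ?e = "\<lambda>m k i j x. pd m (christoffel G k i j) x - 1/2 * pd m (christoffel_first k i j) x"
  have "parity_decay R 1 (2 + 2 * \<delta>) (\<lambda>x. (\<Sum>k\<in>UNIV. ?e k k i j x - ?e j k i k x) +
      (\<Sum>k\<in>UNIV. \<Sum>l\<in>UNIV. christoffel G k k l x * christoffel G l i j x
        - christoffel G k j l x * christoffel G l i k x))"
    by (intro parity_decay_add parity_decay_sum parity_decay_diff pd_christoffel_linear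
        parity_decay_mult[OF christoffel_decay christoffel_decay]) auto
  moreover have "ricci G i j x - linear_ricci i j x = (\<Sum>k\<in>UNIV. ?e k k i j x - ?e j k i k x) +
      (\<Sum>k\<in>UNIV. \<Sum>l\<in>UNIV. christoffel G k k l x * christoffel G l i j x
        - christoffel G k j l x * christoffel G l i k x)" for x
    unfolding ricci_def linear_ricci_def by (simp add: sum_subtractf)
  ultimately show ?thesis
    by simp
qed

lemma ricci_decay: "parity_decay R 1 (2 + \<delta>) (ricci G i j)"
  using parity_decay_add[OF parity_decay_mono[OF ricci_linear[of i j]] linear_ricci_decay[of i j]] \<delta>
      by simp

lemma scalar_linear: "parity_decay R 1 (2 + 2 * \<delta>) (\<lambda>x. scalar_curvature G x - linear_scalar x)"
proof -
  have "parity_decay R 1 (2 + 2 * \<delta>) (\<lambda>x. (\<Sum>i\<in>UNIV. \<Sum>j\<in>UNIV.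
      (ginv G x $ i $ j - mat 1 $ i $ j) * ricci G i j x) + (\<Sum>i\<in>UNIV. ricci G i i x - linear_ricci i
          i x))"
    by (intro parity_decay_add parity_decay_sum ricci_linear
        parity_decay_mult[OF ginv_decay ricci_decay]) auto
  then show ?thesis
    by (simp add: scalar_curvature_def linear_scalar_def left_diff_distrib sum_subtractf sum_mat_1)
qed

subsection \<open>Replacing the induced area form by the round one\<close>

lemma densitized_decay:
  "parity_decay R 1 \<delta> (\<lambda>x. cof3 (G x) j k / sqrt (det (G x)) - mat 1 $ j $ k)"
proof -
  have "parity_decay R 1 \<delta> (\<lambda>x. (inverse (sqrt (det (G x))) - 1) * cof3 (G x) j k
      + (cof3 (G x) j k - mat 1 $ j $ k))"
    by (intro parity_decay_add cof3_decay parity_decay_mult[OF inverse_sqrt_det_decay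
          metric_like_decay[OF metric_like_cof3]]) auto
  then show ?thesis
    by (simp add: field_simps)
qed

lemma sphere_integral_normal:
  assumes "r > R"
  shows "sphere_integral G r (\<lambda>x. \<Sum>j\<in>UNIV. W j x * unit_normal G x $ j)
    = round_integral r (\<lambda>x. \<Sum>j\<in>UNIV. W j x *
        (\<Sum>k\<in>UNIV. cof3 (G x) j k / sqrt (det (G x)) * (x $ k / norm x)))"
  unfolding sphere_integral_def round_integral_def
proof (rule integral_cong)
  fix z assume "z \<in> angles"
  then obtain \<theta> \<phi> where z: "z = (\<theta>, \<phi>)" "0 \<le> \<theta>" "\<theta> \<le> pi" by auto
  let ?x = "sphere_param r \<theta> \<phi>"
  have "r > 0" using assms R by simp
  have "?x \<in> S" using assms R by (intro sphere_param_exterior)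
  then have "unit_normal G ?x $ j * area_density G r \<theta> \<phi>
    = (\<Sum>k\<in>UNIV. cof3 (G ?x) j k / sqrt (det (G ?x)) * (?x $ k / norm ?x)) * (r\<^sup>2 * sin \<theta>)" for j
    using \<open>r > 0\<close> z sin_ge_zero by (intro density_times_normal) (auto intro: sym pos)
  then have *: "W j ?x * unit_normal G ?x $ j * area_density G r \<theta> \<phi>
    = W j ?x * (\<Sum>k\<in>UNIV. cof3 (G ?x) j k / sqrt (det (G ?x)) * (?x $ k / norm ?x)) * (r\<^sup>2 * sin \<theta>)"
        for j
    by (simp only: mult.assoc)
  show "(case z of (\<theta>, \<phi>) \<Rightarrow> (\<Sum>j\<in>UNIV. W j (sphere_param r \<theta> \<phi>) * unit_normal G (sphere_param r \<theta> \<phi>) $ j)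
        * area_density G r \<theta> \<phi>)
      = (\<Sum>j\<in>UNIV. W j (sphere_param r (fst z) (snd z)) *
          (\<Sum>k\<in>UNIV. cof3 (G (sphere_param r (fst z) (snd z))) j k / sqrt (det (G (sphere_param r
              (fst z) (snd z)))) *
            (sphere_param r (fst z) (snd z) $ k / norm (sphere_param r (fst z) (snd z))))) * (r\<^sup>2 *
                sin (fst z))"
    unfolding z(1) prod.case fst_conv snd_conv sum_distrib_right[of _ UNIV] * ..
qed

abbreviation flux :: "real \<Rightarrow> (3 \<Rightarrow> R3 \<Rightarrow> real) \<Rightarrow> real" where
  "flux r W \<equiv> round_integral r (\<lambda>x. \<Sum>j\<in>UNIV. W j x * (x $ j / norm x))"

text \<open>An even field is paired with the odd Euclidean normal, so its flux gains a power of \<open>r\<close>.\<close>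

lemma flux_diff_bigo:
  assumes "\<And>j. parity_decay R 1 (2 * \<delta>) (\<lambda>x. W j x - W' j x)"
    and "\<And>j. continuous_on S (W j)" "\<And>j. continuous_on S (W' j)"
  shows "(\<lambda>r. flux r W - flux r W') \<in> O[at_top](\<lambda>r. r powr (1 - 2 * \<delta>))"
proof -
  have n: "continuous_on S (\<lambda>x. x $ j / norm x)" for j
    using parity_decay_normal[OF R] by (rule parity_decay_continuous)
  have "parity_decay R (-1) (2 * \<delta>) (\<lambda>x. \<Sum>j\<in>UNIV. (W j x - W' j x) * (x $ j / norm x))"
    by (intro parity_decay_sum parity_decay_mult[OF assms(1) parity_decay_normal[OF R]]) auto
  from round_integral_odd_bigo[OF this R] 
  have *: "(\<lambda>r. flux r (\<lambda>j x. W j x - W' j x)) \<in> O[at_top](\<lambda>r. r powr (1 - 2 * \<delta>))" .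
  have "eventually (\<lambda>r. flux r (\<lambda>j x. W j x - W' j x) = flux r W - flux r W') at_top"
    using eventually_gt_at_top[of R]
  proof (rule eventually_mono)
    fix r assume "r > R"
    have "flux r W - flux r W' = round_integral r (\<lambda>x. (\<Sum>j\<in>UNIV. W j x * (x $ j / norm x))
        - (\<Sum>j\<in>UNIV. W' j x * (x $ j / norm x)))"
      by (rule round_integral_diff[OF _ _ R \<open>r > R\<close>, symmetric];
          intro continuous_on_sum continuous_on_mult n assms)
    then show "flux r (\<lambda>j x. W j x - W' j x) = flux r W - flux r W'"
      by (simp add: left_diff_distrib sum_subtractf diff_divide_distrib)
  qed
  then show ?thesis
    using * by (rule landau_o.big.in_cong[THEN iffD1])
qed

text \<open>
  For an even field of order \<open>\<delta>\<close> the metric area form may be replaced by the round one: the error pairs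
  \<open>W\<close> with the even matrix \<open>cof g / sqrt (det g) - \<delta>\<close>, again of order \<open>\<delta>\<close>.
\<close>

lemma sphere_integral_flux:
  assumes W: "\<And>j. parity_decay R 1 \<delta> (W j)"
  shows "(\<lambda>r. sphere_integral G r (\<lambda>x. \<Sum>j\<in>UNIV. W j x * unit_normal G x $ j) - flux r W)
    \<in> O[at_top](\<lambda>r. r powr (1 - 2 * \<delta>))"
proof -
  define M where "M k j x = cof3 (G x) j k / sqrt (det (G x))" for k j x
  define W' where "W' k x = (\<Sum>j\<in>UNIV. W j x * M k j x)" for k x
  have M: "parity_decay R 1 \<delta> (\<lambda>x. M k j x - mat 1 $ j $ k)" for k j
    unfolding M_def by (rule densitized_decay)
  have "parity_decay R 1 (2 * \<delta>) (\<lambda>x. \<Sum>j\<in>UNIV. W j x * (M k j x - mat 1 $ j $ k))" for k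
    by (intro parity_decay_sum parity_decay_mult[OF W M]) auto
  then have diff: "parity_decay R 1 (2 * \<delta>) (\<lambda>x. W' k x - W k x)" for k
  proof (rule parity_decay_cong)
    fix x
    have "(\<Sum>j\<in>UNIV. W j x * mat 1 $ j $ k) = W k x"
      by (simp add: mat_def if_distrib[of "\<lambda>a. _ * a"] cong: if_cong)
    then show "(\<Sum>j\<in>UNIV. W j x * (M k j x - mat 1 $ j $ k)) = W' k x - W k x"
      by (simp add: W'_def right_diff_distrib sum_subtractf)
  qed
  have cW: "continuous_on S (W k)" for k
    using W by (rule parity_decay_continuous)
  have "continuous_on S (\<lambda>x. (W' k x - W k x) + W k x)" for k
    using parity_decay_continuous[OF diff] cW by (rule continuous_on_add)
  then have cW': "continuous_on S (W' k)" for k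
    by simp
  have "eventually (\<lambda>r. flux r W' - flux r W
      = sphere_integral G r (\<lambda>x. \<Sum>j\<in>UNIV. W j x * unit_normal G x $ j) - flux r W) at_top"
    using eventually_gt_at_top[of R]
  proof (rule eventually_mono)
    fix r assume "r > R"
    have "(\<Sum>k\<in>UNIV. W' k x * (x $ k / norm x))
        = (\<Sum>j\<in>UNIV. W j x * (\<Sum>k\<in>UNIV. M k j x * (x $ k / norm x)))" for x
      unfolding W'_def sum_distrib_right sum_distrib_left by (subst sum.swap) (simp add: mult.assoc)
    then show "flux r W' - flux r W
      = sphere_integral G r (\<lambda>x. \<Sum>j\<in>UNIV. W j x * unit_normal G x $ j) - flux r W"
      unfolding sphere_integral_normal[OF \<open>r > R\<close>] M_def by simp
  qed
  then show ?thesis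
    using flux_diff_bigo[OF diff cW' cW] by (rule landau_o.big.in_cong[THEN iffD1])
qed

end

context rt_metric
begin

section \<open>The linearized flux identity\<close>

definition pert :: "3 \<Rightarrow> 3 \<Rightarrow> R3 \<Rightarrow> real" where
  "pert i j x = G x $ i $ j - mat 1 $ i $ j"

text \<open>The vector field whose flux defines the ADM mass.\<close>

definition adm_density :: "3 \<Rightarrow> R3 \<Rightarrow> real" where
  "adm_density j x = (\<Sum>l\<in>UNIV. dG l l j x - dG j l l x)"

text \<open>The vector fields whose Euclidean fluxes are the linear parts of the two fluxes.\<close>

definition cs_field :: "3 \<Rightarrow> 3 \<Rightarrow> R3 \<Rightarrow> real" where
  "cs_field \<alpha> j x = x $ \<alpha> * adm_density j x - (pert j \<alpha> x - mat 1 $ j $ \<alpha> * (\<Sum>i\<in>UNIV. pert i i x))"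

definition einstein_field :: "3 \<Rightarrow> 3 \<Rightarrow> R3 \<Rightarrow> real" where
  "einstein_field \<alpha> j x = (\<Sum>i\<in>UNIV.
     (linear_ricci i j x - 1/2 * linear_scalar x * mat 1 $ i $ j) * Y_field \<alpha> x $ i)"

text \<open>
  The linearized Einstein tensor is \<open>E\<^sub>i\<^sub>j = \<partial>\<^sub>k B\<^sub>i\<^sub>j\<^sub>k\<close> for the following \<open>B\<close>, antisymmetric in \<open>j\<close>
  and \<open>k\<close>. Hence \<open>E\<^sub>i\<^sub>j Y\<^sub>i = \<partial>\<^sub>k (B\<^sub>i\<^sub>j\<^sub>k Y\<^sub>i) - B\<^sub>i\<^sub>j\<^sub>k \<partial>\<^sub>k Y\<^sub>i\<close>, where the last term contains first
  derivatives of \<open>h\<close> with weights linear in \<open>x\<close>.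
\<close>

definition einstein_potential :: "3 \<Rightarrow> 3 \<Rightarrow> 3 \<Rightarrow> R3 \<Rightarrow> real" where
  "einstein_potential i j k x = 1/2 * (dG j i k x - dG k i j x + mat 1 $ i $ k * adm_density j x -
      mat 1 $ i $ j * adm_density k x)"

text \<open>
  A second integration by parts turns that last term, \<open>- B\<^sub>i\<^sub>j\<^sub>k \<partial>\<^sub>k Y\<^sub>i\<close>, into the Corvino--Schoen
  field plus the divergence of the following matrix. It is antisymmetric in \<open>j\<close> and \<open>k\<close>, and
  bilinear in \<open>x\<close> and \<open>h\<close>.
\<close>

definition weight_potential :: "3 \<Rightarrow> 3 \<Rightarrow> 3 \<Rightarrow> R3 \<Rightarrow> real" where
  "weight_potential \<alpha> j k x = x $ k * pert \<alpha> j x - x $ j * pert \<alpha> k x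
     + mat 1 $ \<alpha> $ j * (\<Sum>l\<in>UNIV. x $ l * pert l k x) - mat 1 $ \<alpha> $ k * (\<Sum>l\<in>UNIV. x $ l * pert l j x)
     + (x $ j * mat 1 $ \<alpha> $ k - x $ k * mat 1 $ \<alpha> $ j) * (\<Sum>i\<in>UNIV. pert i i x)"

definition potential :: "3 \<Rightarrow> 3 \<Rightarrow> 3 \<Rightarrow> R3 \<Rightarrow> real" where
  "potential \<alpha> j k x = (\<Sum>i\<in>UNIV. einstein_potential i j k x * Y_field \<alpha> x $ i) + weight_potential \<alpha>
      j k x"

lemma Y_field_nth: "Y_field \<alpha> x $ i = (\<Sum>k\<in>UNIV. x $ k * x $ k) * mat 1 $ \<alpha> $ i - 2 * (x $ \<alpha> * x $ i)"
  by (simp add: Y_field_def axis_def mat_def power2_norm_eq_inner inner_vec_def)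

lemma pd_coord_mat: "pd i (\<lambda>x. x $ j) x = mat 1 $ i $ j"
  by (simp add: pd_coord mat_def)

lemma pert_C1: "C_on 1 (pert i j) S"
  unfolding pert_def by (intro C1_intros G_C1)

lemma adm_density_C1: "C_on 1 (adm_density j) S"
  unfolding adm_density_def by (intro C1_intros dG_C1)

lemma Y_C1: "C_on 1 (\<lambda>x. Y_field \<alpha> x $ i) S"
  unfolding Y_field_nth by (intro C1_intros)

lemma einstein_potential_C1: "C_on 1 (einstein_potential i j k) S"
  unfolding einstein_potential_def by (intro C1_intros dG_C1 adm_density_C1)

lemma weight_potential_C1: "C_on 1 (weight_potential \<alpha> j k) S"
  unfolding weight_potential_def by (intro C1_intros pert_C1)

lemma cs_field_C1: "C_on 1 (cs_field \<alpha> j) S"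
  unfolding cs_field_def by (intro C1_intros pert_C1 adm_density_C1)

lemma potential_C1: "C_on 1 (potential \<alpha> j k) S"
  unfolding potential_def by (intro C1_intros einstein_potential_C1 Y_C1 weight_potential_C1)

lemma potential_antisym: "potential \<alpha> k j x = - potential \<alpha> j k x"
  by (simp add: potential_def einstein_potential_def weight_potential_def sum_negf[symmetric]
      algebra_simps sum.distrib[symmetric] sum_subtractf[symmetric])

lemma pert_sym: "x \<in> S \<Longrightarrow> pert i j x = pert j i x"
  by (simp add: pert_def sym[of x i j] mat_def)

context
  fixes x assumes x: "x \<in> S"
begin

lemma differentiable_at_x [simp]:
  "pert i j differentiable (at x)" "dG k i j differentiable (at x)" "adm_density j differentiable
      (at x)"
  "(\<lambda>x. x $ l) differentiable (at x)" "einstein_potential i j k differentiable (at x)"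
      "weight_potential \<alpha> j k differentiable (at x)"
  "(\<lambda>x. Y_field \<alpha> x $ i) differentiable (at x)" "(\<lambda>x. G x $ i $ j) differentiable (at x)"
  by (rule C1_differentiable[OF _ x], intro pert_C1 dG_C1 adm_density_C1 C1_coord
      einstein_potential_C1 weight_potential_C1 Y_C1 G_C1)+

lemmas pd_rules = pd_add pd_diff pd_mult pd_sum pd_const pd_coord_mat
lemmas diff_rules = differentiable_add differentiable_diff differentiable_mult differentiable_sum
  differentiable_const

lemma pd_pert: "pd k (pert i j) x = dG k i j x"
  unfolding pert_def by (simp add: pd_rules diff_rules)

lemma pd_adm_density: "pd k (adm_density j) x = (\<Sum>l\<in>UNIV. pd k (dG l l j) x - pd k (dG j l l) x)"
  unfolding adm_density_def by (simp add: pd_rules diff_rules)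

lemma pd_einstein_potential: "pd m (einstein_potential i j k) x = 1/2 * (pd m (dG j i k) x - pd m
    (dG k i j) x
    + mat 1 $ i $ k * pd m (adm_density j) x - mat 1 $ i $ j * pd m (adm_density k) x)"
  unfolding einstein_potential_def by (subst pd_cmult) (simp_all add: pd_rules diff_rules)

lemma pd_Y: "pd k (\<lambda>x. Y_field \<alpha> x $ i) x
    = 2 * x $ k * mat 1 $ \<alpha> $ i - 2 * (mat 1 $ k $ \<alpha> * x $ i + x $ \<alpha> * mat 1 $ k $ i)"
proof -
  have "(\<Sum>l\<in>UNIV. mat 1 $ k $ l * x $ l + x $ l * mat 1 $ k $ l) = 2 * x $ k"
    by (simp add: mult.commute[of "x $ _"] sum_mat_1 sum_distrib_left[symmetric])
  then show ?thesis
    unfolding Y_field_nth by (simp add: pd_rules diff_rules)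
qed

lemma pd_weight_potential: "pd m (weight_potential \<alpha> j k) x =
    (mat 1 $ m $ k * pert \<alpha> j x + x $ k * dG m \<alpha> j x) - (mat 1 $ m $ j * pert \<alpha> k x + x $ j * dG m \<alpha>
        k x)
    + mat 1 $ \<alpha> $ j * (\<Sum>l\<in>UNIV. mat 1 $ m $ l * pert l k x + x $ l * dG m l k x)
    - mat 1 $ \<alpha> $ k * (\<Sum>l\<in>UNIV. mat 1 $ m $ l * pert l j x + x $ l * dG m l j x)
    + ((mat 1 $ m $ j * mat 1 $ \<alpha> $ k - mat 1 $ m $ k * mat 1 $ \<alpha> $ j) * (\<Sum>i\<in>UNIV. pert i i x)
       + (x $ j * mat 1 $ \<alpha> $ k - x $ k * mat 1 $ \<alpha> $ j) * (\<Sum>i\<in>UNIV. dG m i i x))"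
  unfolding weight_potential_def by (simp add: pd_rules diff_rules pd_pert)

lemma pd_cs_field: "pd k (cs_field \<alpha> j) x = mat 1 $ k $ \<alpha> * adm_density j x + x $ \<alpha> * pd k
    (adm_density j) x
    - (dG k j \<alpha> x - mat 1 $ j $ \<alpha> * (\<Sum>i\<in>UNIV. dG k i i x))"
  unfolding cs_field_def by (simp add: pd_rules diff_rules pd_pert)

lemma linear_scalar_eq: "linear_scalar x = (\<Sum>j\<in>UNIV. pd j (adm_density j) x)"
proof -
  have "linear_scalar x = (\<Sum>i\<in>UNIV. \<Sum>k\<in>UNIV. pd k (dG i i k) x - 1/2 * pd k (dG k i i) x)
      - (\<Sum>i\<in>UNIV. \<Sum>k\<in>UNIV. 1/2 * pd i (dG i k k) x)"
    unfolding linear_scalar_def linear_ricci_def pd_christoffel_first[OF x] sum_subtractf[symmetric]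
    by (intro sum.cong refl) (simp add: ddG_sym[OF x, of _ _ _ _] algebra_simps)
  also have "(\<Sum>i\<in>UNIV. \<Sum>k\<in>UNIV. 1/2 * pd i (dG i k k) x) = (\<Sum>i\<in>UNIV. \<Sum>k\<in>UNIV. 1/2 * pd k (dG k i i) x)"
    by (rule sum.swap)
  also have "(\<Sum>i\<in>UNIV. \<Sum>k\<in>UNIV. pd k (dG i i k) x - 1/2 * pd k (dG k i i) x) - \<dots>
      = (\<Sum>i\<in>UNIV. \<Sum>k\<in>UNIV. pd k (dG i i k) x - pd k (dG k i i) x)"
    unfolding sum_subtractf[symmetric] by (intro sum.cong refl) simp
  also have "\<dots> = (\<Sum>j\<in>UNIV. pd j (adm_density j) x)"
    unfolding pd_adm_density by (rule sum.swap)
  finally show ?thesis .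
qed

text \<open>
  The zeroth-order part of the field is chosen such that its divergence cancels the derivative that
  falls on the weight \<open>x\<^sup>\<alpha>\<close>.
\<close>

lemma div_cs_field: "(\<Sum>j\<in>UNIV. pd j (cs_field \<alpha> j) x) = x $ \<alpha> * linear_scalar x"
proof -
  have "(\<Sum>j\<in>UNIV. mat 1 $ j $ \<alpha> * adm_density j x) = adm_density \<alpha> x"
    "(\<Sum>j\<in>UNIV. mat 1 $ j $ \<alpha> * (\<Sum>i\<in>UNIV. dG j i i x)) = (\<Sum>i\<in>UNIV. dG \<alpha> i i x)"
    by (simp_all add: mat_def if_distrib[of "\<lambda>a. a * _"] cong: if_cong)
  then show ?thesis
    by (simp add: pd_cs_field linear_scalar_eq sum.distrib sum_subtractf sum_distrib_left
        adm_density_def)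
qed

text \<open>
  The trace terms of \<open>B\<close> produce the linearized scalar curvature and the mixed terms of the linearized
  Ricci tensor, the latter after commuting derivatives.
\<close>

lemma div_einstein_potential: "(\<Sum>k\<in>UNIV. pd k (einstein_potential i j k) x) = linear_ricci i j x -
    1/2 * linear_scalar x * mat 1 $ i $ j"
proof -
  have "(\<Sum>k\<in>UNIV. pd k (einstein_potential i j k) x) = 1/2 * (\<Sum>k\<in>UNIV. pd k (dG j i k) x - pd k (dG
      k i j) x)
      + 1/2 * (\<Sum>k\<in>UNIV. mat 1 $ i $ k * pd k (adm_density j) x) - 1/2 * mat 1 $ i $ j * linear_scalar x"
    unfolding pd_einstein_potential linear_scalar_eq
    by (simp add: sum.distrib sum_subtractf sum_distrib_left mult_ac right_diff_distrib distrib_left)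
  also have "(\<Sum>k\<in>UNIV. mat 1 $ i $ k * pd k (adm_density j) x) = (\<Sum>k\<in>UNIV. pd i (dG k k j) x - pd i
      (dG j k k) x)"
    by (simp add: sum_mat_1 pd_adm_density)
  also have "1/2 * (\<Sum>k\<in>UNIV. pd k (dG j i k) x - pd k (dG k i j) x)
      + 1/2 * (\<Sum>k\<in>UNIV. pd i (dG k k j) x - pd i (dG j k k) x) = linear_ricci i j x"
    unfolding linear_ricci_def pd_christoffel_first[OF x] sum_distrib_left sum.distrib[symmetric]
  proof (intro sum.cong refl)
    fix k
    have "pd i (dG k k j) x = pd k (dG i j k) x"
      using ddG_commute[OF x, of i k k j] ddG_sym[OF x, of k i k j] by simp
    moreover have "pd i (dG j k k) x = pd j (dG i k k) x"
      by (rule ddG_commute[OF x])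
    moreover have "pd j (dG k i k) x = pd j (dG k k i) x"
      by (rule ddG_sym[OF x])
    ultimately show "1/2 * (pd k (dG j i k) x - pd k (dG k i j) x) + 1/2 * (pd i (dG k k j) x - pd i
        (dG j k k) x)
      = 1/2 * (pd k (dG i j k) x + pd k (dG j i k) x - pd k (dG k i j) x)
        - 1/2 * (pd j (dG i k k) x + pd j (dG k i k) x - pd j (dG k i k) x)"
      by (simp add: algebra_simps)
  qed
  finally show ?thesis
    by simp
qed

text \<open>
  An identity between polynomials in \<open>x\<close>, \<open>h\<close> and the first derivatives of \<open>h\<close> that uses nothing but
  the symmetry of \<open>h\<close>. It is verified component by component.
\<close>

lemma first_order_identity:
  "(\<Sum>k\<in>UNIV. \<Sum>i\<in>UNIV. einstein_potential i j k x * pd k (\<lambda>x. Y_field \<alpha> x $ i) x) + (\<Sum>k\<in>UNIV. pd k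
      (weight_potential \<alpha> j k) x)
     = - cs_field \<alpha> j x"
proof -
  note d = dG_sym[OF x, of _ 2 1] dG_sym[OF x, of _ 3 1] dG_sym[OF x, of _ 3 2]
  note h = pert_sym[OF x, of 2 1] pert_sym[OF x, of 3 1] pert_sym[OF x, of 3 2]
  have m: "mat 1 $ (i::3) $ j = (if i = j then 1 else 0 :: real)" for i j
    by (simp add: mat_def)
  show ?thesis
    using exhaust_3[of \<alpha>] exhaust_3[of j] unfolding pd_Y pd_weight_potential einstein_potential_def
        cs_field_def adm_density_def
    by (elim disjE; simp add: sum_3 m d h; simp add: algebra_simps)
qed

text \<open>
  The key identity, assembled from its part with second derivatives of the metric
  (\<open>div_einstein_potential\<close>) and its part of lower order (\<open>first_order_identity\<close>). Since \<open>potential\<close> is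
  antisymmetric in \<open>j\<close> and \<open>k\<close>, the right-hand side has no flux through spheres.
\<close>

lemma einstein_minus_cs: "einstein_field \<alpha> j x - cs_field \<alpha> j x = (\<Sum>k\<in>UNIV. pd k (potential \<alpha> j k) x)"
proof -
  have "pd k (potential \<alpha> j k) x = (\<Sum>i\<in>UNIV. pd k (einstein_potential i j k) x * Y_field \<alpha> x $ i)
      + (\<Sum>i\<in>UNIV. einstein_potential i j k x * pd k (\<lambda>x. Y_field \<alpha> x $ i) x) + pd k
          (weight_potential \<alpha> j k) x" for k
    unfolding potential_def by (simp add: pd_rules diff_rules sum.distrib)
  then have "(\<Sum>k\<in>UNIV. pd k (potential \<alpha> j k) x)
      = (\<Sum>k\<in>UNIV. \<Sum>i\<in>UNIV. pd k (einstein_potential i j k) x * Y_field \<alpha> x $ i) - cs_field \<alpha> j x"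
    using first_order_identity[of j \<alpha>] by (simp add: sum.distrib)
  also have "(\<Sum>k\<in>UNIV. \<Sum>i\<in>UNIV. pd k (einstein_potential i j k) x * Y_field \<alpha> x $ i) =
      einstein_field \<alpha> j x"
    unfolding einstein_field_def div_einstein_potential[symmetric] sum_distrib_right by (rule sum.swap)
  finally show ?thesis
    by simp
qed

end

section \<open>Comparison of the two fluxes\<close>

lemma pert_decay: "parity_decay R 1 \<delta> (pert i j)"
  unfolding pert_def by (rule G_decay)

lemma adm_density_decay: "parity_decay R (-1) (1 + \<delta>) (adm_density j)"
  unfolding adm_density_def by (intro parity_decay_sum parity_decay_diff dG_decay)

lemma coord_adm_density_decay: "parity_decay R 1 \<delta> (\<lambda>x. x $ \<alpha> * adm_density j x)"
  by (rule parity_decay_mult[OF parity_decay_coord adm_density_decay]) auto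

lemma trace_part_decay: "parity_decay R 1 \<delta> (\<lambda>x. pert j \<alpha> x - mat 1 $ j $ \<alpha> * (\<Sum>i\<in>UNIV. pert i i x))"
  by (intro parity_decay_diff parity_decay_cmult parity_decay_sum pert_decay)

lemma Y_decay: "parity_decay R 1 (-2) (\<lambda>x. Y_field \<alpha> x $ i)"
proof -
  have xx: "parity_decay R 1 (-2) (\<lambda>x. x $ k * x $ l)" for k l
    by (rule parity_decay_mult[OF parity_decay_coord parity_decay_coord]) auto
  then have "parity_decay R 1 (-2) (\<lambda>x. mat 1 $ \<alpha> $ i * (\<Sum>k\<in>UNIV. x $ k * x $ k) - 2 * (x $ \<alpha> * x $ i))"
    by (intro parity_decay_diff parity_decay_cmult parity_decay_sum)
  then show ?thesis
    by (simp add: Y_field_nth mult.commute)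
qed

lemma linear_scalar_decay: "parity_decay R 1 (2 + \<delta>) linear_scalar"
  unfolding linear_scalar_def by (intro parity_decay_sum linear_ricci_decay)

lemma einstein_field_decay: "parity_decay R 1 \<delta> (einstein_field \<alpha> j)"
proof -
  have "parity_decay R 1 (2 + \<delta>) (\<lambda>x. linear_ricci i j x - 1/2 * mat 1 $ i $ j * linear_scalar x)" for i
    by (intro parity_decay_diff parity_decay_cmult linear_ricci_decay linear_scalar_decay)
  then have "parity_decay R 1 \<delta> (\<lambda>x. \<Sum>i\<in>UNIV.
      (linear_ricci i j x - 1/2 * mat 1 $ i $ j * linear_scalar x) * Y_field \<alpha> x $ i)"
    by (intro parity_decay_sum) (rule parity_decay_mult[OF _ Y_decay], auto)
  then show ?thesis
    unfolding einstein_field_def by (simp add: mult_ac)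
qed

lemma flux_einstein_eq_cs:
  assumes "R < r"
  shows "flux r (einstein_field \<alpha>) = flux r (cs_field \<alpha>)"
proof -
  have n: "continuous_on S (\<lambda>x. x $ j / norm x)" for j
    using parity_decay_normal[OF R] by (rule parity_decay_continuous)
  have "flux r (einstein_field \<alpha>) - flux r (cs_field \<alpha>) = round_integral r (\<lambda>x.
      (\<Sum>j\<in>UNIV. einstein_field \<alpha> j x * (x $ j / norm x)) - (\<Sum>j\<in>UNIV. cs_field \<alpha> j x * (x $ j / norm
          x)))"
    by (rule round_integral_diff[OF _ _ R assms, symmetric]; intro continuous_on_sum
        continuous_on_mult n
        parity_decay_continuous[OF einstein_field_decay] C_on_continuous[OF cs_field_C1])
  also have "\<dots> = round_integral r (\<lambda>x. \<Sum>j\<in>UNIV. (\<Sum>k\<in>UNIV. pd k (potential \<alpha> j k) x) * (x $ j / norm x))"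
  proof (rule round_integral_cong)
    fix x :: R3 assume "norm x = r"
    then have "x \<in> S" using assms by (simp add: exterior_def)
    then show "(\<Sum>j\<in>UNIV. einstein_field \<alpha> j x * (x $ j / norm x)) - (\<Sum>j\<in>UNIV. cs_field \<alpha> j x * (x $
        j / norm x))
        = (\<Sum>j\<in>UNIV. (\<Sum>k\<in>UNIV. pd k (potential \<alpha> j k) x) * (x $ j / norm x))"
      by (simp only: einstein_minus_cs[symmetric] left_diff_distrib sum_subtractf)
  qed (use assms R in simp)
  also have "\<dots> = 0"
    by (rule round_flux_antisymmetric_divergence[OF potential_C1 R assms potential_antisym])
  finally show ?thesis by simp
qed

lemma intrinsic_flux_asymptotic:
  assumes scalar: "parity_decay R 1 (2 + 2 * \<delta>) (scalar_curvature G)"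
  shows "(\<lambda>r. intrinsic_flux G \<alpha> r - flux r (cs_field \<alpha>)) \<in> O[at_top](\<lambda>r. r powr (1 - 2 * \<delta>))"
proof -
  define W where "W j x = (\<Sum>i\<in>UNIV. (ricci G i j x - 1/2 * scalar_curvature G x * G x $ i $ j) *
      Y_field \<alpha> x $ i)" for j x
  have sG: "parity_decay R 1 (2 + 2 * \<delta>) (\<lambda>x. 1/2 * (scalar_curvature G x * G x $ i $ j))" for i j
    by (intro parity_decay_cmult parity_decay_mult[OF scalar metric_like_decay[OF metric_like_G]]) auto
  have "parity_decay R 1 (2 + \<delta>) (\<lambda>x. ricci G i j x - 1/2 * (scalar_curvature G x * G x $ i $ j))"
      for i j
    using \<delta> by (intro parity_decay_diff ricci_decay parity_decay_mono[OF sG]) auto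
  then have "parity_decay R 1 \<delta> (\<lambda>x. \<Sum>i\<in>UNIV.
      (ricci G i j x - 1/2 * (scalar_curvature G x * G x $ i $ j)) * Y_field \<alpha> x $ i)" for j
    by (intro parity_decay_sum) (rule parity_decay_mult[OF _ Y_decay], auto)
  then have W: "parity_decay R 1 \<delta> (W j)" for j
    unfolding W_def by (simp add: mult.assoc)
  have lin: "parity_decay R 1 (2 + 2 * \<delta>) linear_scalar"
    using parity_decay_diff[OF scalar scalar_linear] by simp
  have "parity_decay R 1 (2 + 2 * \<delta>) (\<lambda>x. (ricci G i j x - linear_ricci i j x)
      - 1/2 * (scalar_curvature G x * G x $ i $ j) + 1/2 * mat 1 $ i $ j * linear_scalar x)" for i j
    by (intro parity_decay_add parity_decay_diff ricci_linear sG parity_decay_cmult lin)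
  then have "parity_decay R 1 (2 * \<delta>) (\<lambda>x. \<Sum>i\<in>UNIV. ((ricci G i j x - linear_ricci i j x)
      - 1/2 * (scalar_curvature G x * G x $ i $ j) + 1/2 * mat 1 $ i $ j * linear_scalar x) *
          Y_field \<alpha> x $ i)" for j
    by (intro parity_decay_sum) (rule parity_decay_mult[OF _ Y_decay], auto)
  then have diff: "parity_decay R 1 (2 * \<delta>) (\<lambda>x. W j x - einstein_field \<alpha> j x)" for j
    by (rule parity_decay_cong)
       (simp add: W_def einstein_field_def sum_subtractf[symmetric] left_diff_distrib[symmetric]
           algebra_simps)
  have 1: "(\<lambda>r. sphere_integral G r (\<lambda>x. \<Sum>j\<in>UNIV. W j x * unit_normal G x $ j) - flux r W)
      \<in> O[at_top](\<lambda>r. r powr (1 - 2 * \<delta>))"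
    by (rule sphere_integral_flux[OF W])
  have 2: "(\<lambda>r. flux r W - flux r (einstein_field \<alpha>)) \<in> O[at_top](\<lambda>r. r powr (1 - 2 * \<delta>))"
    by (intro flux_diff_bigo diff parity_decay_continuous[OF W] parity_decay_continuous[OF
        einstein_field_decay])
  have int: "intrinsic_flux G \<alpha> r = sphere_integral G r (\<lambda>x. \<Sum>j\<in>UNIV. W j x * unit_normal G x $ j)"
      for r
    unfolding intrinsic_flux_def W_def sum_distrib_right by (subst sum.swap) simp
  have "eventually (\<lambda>r. (sphere_integral G r (\<lambda>x. \<Sum>j\<in>UNIV. W j x * unit_normal G x $ j) - flux r W)
      + (flux r W - flux r (einstein_field \<alpha>)) = intrinsic_flux G \<alpha> r - flux r (cs_field \<alpha>)) at_top"
    using eventually_gt_at_top[of R]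
  proof (rule eventually_mono)
    fix r assume "r > R"
    then show "(sphere_integral G r (\<lambda>x. \<Sum>j\<in>UNIV. W j x * unit_normal G x $ j) - flux r W)
      + (flux r W - flux r (einstein_field \<alpha>)) = intrinsic_flux G \<alpha> r - flux r (cs_field \<alpha>)"
      unfolding int using flux_einstein_eq_cs[of r \<alpha>] by linarith
  qed
  then show ?thesis
    using sum_in_bigo(1)[OF 1 2] by (rule landau_o.big.in_cong[THEN iffD1])
qed

lemma corvino_schoen_flux_asymptotic:
  "(\<lambda>r. corvino_schoen_flux G \<alpha> r - flux r (cs_field \<alpha>)) \<in> O[at_top](\<lambda>r. r powr (1 - 2 * \<delta>))"
proof -
  define P where "P j x = x $ \<alpha> * adm_density j x" for j x
  define Q where "Q j x = pert j \<alpha> x - mat 1 $ j $ \<alpha> * (\<Sum>i\<in>UNIV. pert i i x)" for j x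
  have P: "parity_decay R 1 \<delta> (P j)" and Q: "parity_decay R 1 \<delta> (Q j)" for j
    unfolding P_def Q_def by (rule coord_adm_density_decay trace_part_decay)+
  let ?I = "\<lambda>W r. sphere_integral G r (\<lambda>x. \<Sum>j\<in>UNIV. W j x * unit_normal G x $ j)"
  have n: "continuous_on S (\<lambda>x. x $ j / norm x)" for j
    using parity_decay_normal[OF R] by (rule parity_decay_continuous)
  have cs: "corvino_schoen_flux G \<alpha> r = ?I P r - ?I Q r" for r
  proof -
    have "(\<Sum>i\<in>UNIV. \<Sum>j\<in>UNIV. x $ \<alpha> * (dG i i j x - dG j i i x) * unit_normal G x $ j)
        = (\<Sum>j\<in>UNIV. P j x * unit_normal G x $ j)" for x
      unfolding P_def adm_density_def sum_distrib_left sum_distrib_right by (rule sum.swap)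
    moreover have "(let h = G x - mat 1; \<nu> = unit_normal G x in \<Sum>i\<in>UNIV. h $ i $ \<alpha> * \<nu> $ i - h $ i $
        i * \<nu> $ \<alpha>)
        = (\<Sum>j\<in>UNIV. Q j x * unit_normal G x $ j)" for x
    proof -
      have "(\<Sum>j\<in>UNIV. mat 1 $ j $ \<alpha> * (\<Sum>i\<in>UNIV. pert i i x) * unit_normal G x $ j)
          = (\<Sum>i\<in>UNIV. pert i i x) * unit_normal G x $ \<alpha>"
        by (simp add: mat_def if_distrib[of "\<lambda>a. a * _"] cong: if_cong)
      then show ?thesis
        by (simp add: Let_def Q_def pert_def left_diff_distrib sum_subtractf sum_distrib_right)
    qed
    ultimately show ?thesis
      by (simp add: corvino_schoen_flux_def)
  qed
  have "eventually (\<lambda>r. (?I P r - flux r P) - (?I Q r - flux r Q)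
      = corvino_schoen_flux G \<alpha> r - flux r (cs_field \<alpha>)) at_top"
    using eventually_gt_at_top[of R]
  proof (rule eventually_mono)
    fix r assume "r > R"
    have "flux r P - flux r Q = round_integral r (\<lambda>x. (\<Sum>j\<in>UNIV. P j x * (x $ j / norm x))
        - (\<Sum>j\<in>UNIV. Q j x * (x $ j / norm x)))"
      by (rule round_integral_diff[OF _ _ R \<open>r > R\<close>, symmetric]; intro continuous_on_sum
          continuous_on_mult n parity_decay_continuous[OF P] parity_decay_continuous[OF Q])
    also have "\<dots> = flux r (cs_field \<alpha>)"
      by (simp add: cs_field_def P_def[symmetric] Q_def[symmetric] left_diff_distrib sum_subtractf
          diff_divide_distrib)
    finally show "(?I P r - flux r P) - (?I Q r - flux r Q)
      = corvino_schoen_flux G \<alpha> r - flux r (cs_field \<alpha>)"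
      by (simp add: cs)
  qed
  then show ?thesis
    using sum_in_bigo(2)[OF sphere_integral_flux[OF P] sphere_integral_flux[OF Q]]
    by (rule landau_o.big.in_cong[THEN iffD1])
qed

lemma cs_flux_derivative:
  assumes "R < r"
  shows "((\<lambda>r. flux r (cs_field \<alpha>)) has_real_derivative
    round_integral r (\<lambda>x. x $ \<alpha> * linear_scalar x)) (at r)"
proof -
  have "round_integral r (\<lambda>x. \<Sum>j\<in>UNIV. pd j (cs_field \<alpha> j) x) = round_integral r (\<lambda>x. x $ \<alpha> *
      linear_scalar x)"
    using assms R by (intro round_integral_cong div_cs_field) (auto simp: exterior_def)
  then show ?thesis
    using has_real_derivative_round_flux[of "cs_field \<alpha>", OF cs_field_C1 R assms] by (simp only:)
qed

end

text \<open>
  Let \<open>q(r) = C/(p-1) r\<^sup>1\<^sup>-\<^sup>p\<close> be the integral of the bound \<open>C t\<^sup>-\<^sup>p\<close> over \<open>t \<ge> r\<close>. For large \<open>r\<close>, \<open>f - q\<close>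
  increases and \<open>f + q\<close> decreases, so
  \<open>f - q\<close> is bounded and monotone, and \<open>q\<close> tends to zero.
\<close>

lemma tendsto_at_top_integrable_derivative:
  fixes f f' :: "real \<Rightarrow> real"
  assumes deriv: "\<And>r. r > R \<Longrightarrow> (f has_real_derivative f' r) (at r)"
    and bound: "f' \<in> O[at_top](\<lambda>r. r powr (- p))" and "p > 1"
  shows "\<exists>L. (f \<longlongrightarrow> L) at_top"
proof -
  obtain C where C: "C > 0" "eventually (\<lambda>r. norm (f' r) \<le> C * norm (r powr (- p))) at_top"
    using bound by (elim landau_o.bigE)
  from C(2) have "eventually (\<lambda>r. \<bar>f' r\<bar> \<le> C * r powr (- p) \<and> r > R \<and> r > 0) at_top"
    using eventually_gt_at_top[of R] eventually_gt_at_top[of 0] by eventually_elim simp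
  then obtain N where N: "\<And>r. r \<ge> N \<Longrightarrow> \<bar>f' r\<bar> \<le> C * r powr (- p) \<and> r > R \<and> r > 0"
    by (auto simp: eventually_at_top_linorder)
  define q where "q r = C / (p - 1) * r powr (1 - p)" for r
  have q': "(q has_real_derivative - (C * r powr (- p))) (at r)" if "r \<ge> N" for r
  proof -
    have "r > 0" using N[OF that] by simp
    then have "(q has_real_derivative C / (p - 1) * ((1 - p) * r powr (1 - p - 1))) (at r)"
      unfolding q_def using \<open>p > 1\<close> by (auto intro!: derivative_eq_intros)
    moreover have "C / (p - 1) * ((1 - p) * r powr (1 - p - 1)) = - (C * r powr (- p))"
      using \<open>p > 1\<close> by (simp add: divide_simps) (simp add: algebra_simps)
    ultimately show ?thesis by simp
  qed
  have q_nonneg: "q r \<ge> 0" for r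
    using \<open>p > 1\<close> C(1) by (simp add: q_def)
  have up: "f a - q a \<le> f b - q b" if "N \<le> a" "a \<le> b" for a b
  proof (rule DERIV_nonneg_imp_nondecreasing[OF \<open>a \<le> b\<close>])
    fix x assume "a \<le> x" "x \<le> b"
    then have "x \<ge> N" using that by simp
    then have x: "x > R" "\<bar>f' x\<bar> \<le> C * x powr (- p)" using N[of x] by auto
    have "((\<lambda>r. f r - q r) has_real_derivative f' x - - (C * x powr (- p))) (at x)"
      by (rule DERIV_diff[OF deriv[OF x(1)] q'[OF \<open>x \<ge> N\<close>]])
    with x(2) show "\<exists>y. ((\<lambda>r. f r - q r) has_real_derivative y) (at x) \<and> 0 \<le> y"
      by (intro exI conjI) (assumption, linarith)
  qed
  have down: "f b + q b \<le> f a + q a" if "N \<le> a" "a \<le> b" for a b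
  proof (rule DERIV_nonpos_imp_nonincreasing[OF \<open>a \<le> b\<close>])
    fix x assume "a \<le> x" "x \<le> b"
    then have "x \<ge> N" using that by simp
    then have x: "x > R" "\<bar>f' x\<bar> \<le> C * x powr (- p)" using N[of x] by auto
    have "((\<lambda>r. f r + q r) has_real_derivative f' x + - (C * x powr (- p))) (at x)"
      by (rule DERIV_add[OF deriv[OF x(1)] q'[OF \<open>x \<ge> N\<close>]])
    with x(2) show "\<exists>y. ((\<lambda>r. f r + q r) has_real_derivative y) (at x) \<and> y \<le> 0"
      by (intro exI conjI) (assumption, linarith)
  qed
  \<comment> \<open>Freezing the value below \<open>N\<close> makes \<open>f - q\<close> monotone on the whole line.\<close>
  define g where "g r = f (max N r) - q (max N r)" for r
  have "mono g"
    unfolding g_def by (intro monoI up) auto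
  have "g r \<le> f N + q N" for r
    using down[of N "max N r"] q_nonneg[of "max N r"] by (simp add: g_def)
  then obtain L where "(\<lambda>n. g (real n)) \<longlonglongrightarrow> L"
    using incseq_convergent[of "\<lambda>n. g (real n)" "f N + q N"] \<open>mono g\<close>
    unfolding incseq_def mono_def by (metis of_nat_le_iff)
  then have "(g \<longlongrightarrow> L) at_top"
    using \<open>mono g\<close> by (intro tendsto_at_topI_sequentially_real)
  moreover have "(q \<longlongrightarrow> 0) at_top"
    unfolding q_def using \<open>p > 1\<close> by (intro tendsto_mult_right_zero tendsto_neg_powr
        filterlim_ident) simp
  ultimately have "((\<lambda>r. g r + q r) \<longlongrightarrow> L + 0) at_top"
    by (rule tendsto_add)
  moreover have "eventually (\<lambda>r. g r + q r = f r) at_top"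
    using eventually_ge_at_top[of N] by eventually_elim (simp add: g_def)
  ultimately show ?thesis
    using tendsto_cong by force
qed

text \<open>
  Even decay of the scalar curvature at the rate \<open>2 + 2 \<delta>\<close> is what the constraint contributes: it turns
  the derivative of the linear flux from \<open>O(r\<^sup>-\<^sup>\<delta>)\<close> into the integrable \<open>O(r\<^sup>-\<^sup>2\<^sup>\<delta>)\<close>.
\<close>

theorem (in rt_metric) center_fluxes_converge:
  assumes scalar: "parity_decay R 1 (2 + 2 * \<delta>) (scalar_curvature G)"
  obtains L where "(intrinsic_flux G \<alpha> \<longlongrightarrow> L) at_top" "(corvino_schoen_flux G \<alpha> \<longlongrightarrow> L) at_top"
proof -
  have "parity_decay R 1 (2 + 2 * \<delta>) linear_scalar"
    using parity_decay_diff[OF scalar scalar_linear] by simp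
  then have "parity_decay R (-1) (1 + 2 * \<delta>) (\<lambda>x. x $ \<alpha> * linear_scalar x)"
    by (rule parity_decay_mult[OF parity_decay_coord]) auto
  from round_integral_odd_bigo[OF this R]
  have *: "(\<lambda>r. round_integral r (\<lambda>x. x $ \<alpha> * linear_scalar x)) \<in> O[at_top](\<lambda>r. r powr (- (2 * \<delta>)))"
    by simp
  have "\<exists>L. ((\<lambda>r. flux r (cs_field \<alpha>)) \<longlongrightarrow> L) at_top"
    by (rule tendsto_at_top_integrable_derivative[of R, OF cs_flux_derivative *]) (use \<delta> in auto)
  then obtain L where L: "((\<lambda>r. flux r (cs_field \<alpha>)) \<longlongrightarrow> L) at_top" ..
  have err: "(e \<longlongrightarrow> 0) at_top" if e: "e \<in> O[at_top](\<lambda>r. r powr (1 - 2 * \<delta>))" for e :: "real \<Rightarrow> real"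
  proof -
    obtain c where "eventually (\<lambda>r. norm (e r) \<le> c * norm (r powr (1 - 2 * \<delta>))) at_top"
      using e by (elim landau_o.bigE)
    moreover have "((\<lambda>r. c * norm (r powr (1 - 2 * \<delta>))) \<longlongrightarrow> 0) at_top"
      using \<delta> by (intro tendsto_mult_right_zero tendsto_norm_zero tendsto_neg_powr filterlim_ident) simp
    ultimately show ?thesis
      by (rule Lim_null_comparison)
  qed
  show ?thesis
  proof (rule that)
    show "(intrinsic_flux G \<alpha> \<longlongrightarrow> L) at_top"
      using tendsto_add[OF err[OF intrinsic_flux_asymptotic[OF scalar, of \<alpha>]] L] by simp
    show "(corvino_schoen_flux G \<alpha> \<longlongrightarrow> L) at_top"
      using tendsto_add[OF err[OF corvino_schoen_flux_asymptotic[of \<alpha>]] L] by simp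
  qed
qed

section \<open>Equality of the centers of mass\<close>

text \<open>
  The Hamiltonian constraint writes the scalar curvature as a quadratic expression in \<open>K\<close>. Since \<open>K\<close>
  is odd of order \<open>1 + \<delta>\<close>, its square is even of order \<open>2 + 2 \<delta>\<close>.
\<close>

lemma AF_RT_imp_rt_metric:
  assumes V: "vacuum_initial_data M A g K" and RT: "AF_RT M A g K c"
  obtains R \<delta> where "rt_metric (g c) R \<delta>" "parity_decay R 1 (2 + 2 * \<delta>) (scalar_curvature (g c))"
proof -
  obtain \<delta> where AF: "AF \<delta> M A g K c"
    and g_odd: "\<And>i j. decays 3 (1 + \<delta>) (\<lambda>x. g c x $ i $ j - g c (- x) $ i $ j)"
    and K_even: "\<And>i j. decays 2 (2 + \<delta>) (\<lambda>x. K c x $ i $ j + K c (- x) $ i $ j)"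
    using RT unfolding AF_RT_def by blast
  have c: "c \<in> A" and "end_chart M c" and \<delta>: "1/2 < \<delta>"
    and g_dec: "\<And>i j. decays 3 \<delta> (\<lambda>x. g c x $ i $ j - mat 1 $ i $ j)"
    and K_dec: "\<And>i j. decays 2 (1 + \<delta>) (\<lambda>x. K c x $ i $ j)"
    using AF unfolding AF_def by blast+
  then obtain R where R: "R > 0" "chart_image c = exterior R"
    unfolding end_chart_def exterior_def by blast
  let ?G = "g c" and ?S = "exterior R"
  have metric: "riemannian_metric 3 A g" and K: "symmetric_tensor2 2 A K"
    and con0: "\<forall>x\<in>chart_image c. scalar_curvature ?G x - norm2_g ?G (K c) x + (tr_g ?G (K c) x)\<^sup>2 = 0"
    using V c unfolding vacuum_initial_data_def by blast+
  have con: "scalar_curvature ?G x = norm2_g ?G (K c) x - (tr_g ?G (K c) x)\<^sup>2" if "x \<in> ?S" for x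
    using bspec[OF con0[unfolded R(2)] that] by linarith
  have C3: "C_on 3 (\<lambda>x. ?G x $ i $ j) ?S" for i j
    using metric c unfolding riemannian_metric_def symmetric_tensor2_def R(2)[symmetric] by blast
  have C2: "C_on 2 (\<lambda>x. ?G x $ i $ j) ?S" for i j
    using C3 by (rule C_on_mono) simp
  have CK: "C_on 2 (\<lambda>x. K c x $ i $ j) ?S" for i j
    using K c unfolding symmetric_tensor2_def R(2)[symmetric] by blast
  let ?h = "\<lambda>i j x. ?G x $ i $ j - mat 1 $ i $ j"
  have diff: "(\<lambda>x. ?G x $ i $ j) differentiable (at x)" if "x \<in> ?S" for i j x
    by (rule C1_differentiable[OF C_on_mono[OF C2] that]) simp
  have pd_h: "pd k (?h i j) x = pd k (\<lambda>x. ?G x $ i $ j) x" if "x \<in> ?S" for i j k x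
    using diff[OF that] by (simp add: pd_diff pd_const)
  have h_decay: "parity_decay R (1 * (-1) ^ length ks) (\<delta> + length ks) (pds ks (?h i j))" if "length
      ks \<le> 3" for ks i j
    using g_odd[of i j] that
    by (intro parity_decay_pds[OF g_dec] C_on_diff_const open_exterior C3) (simp_all add: add.commute)
  interpret rt_metric ?G R \<delta>
  proof
    show "0 \<le> R" "1 / 2 < \<delta>" using R \<delta> by simp_all
  next
    fix x i j assume "x \<in> ?S"
    then show "?G x $ i $ j = ?G x $ j $ i"
      using metric c unfolding riemannian_metric_def symmetric_tensor2_def R(2)[symmetric] by blast
  next
    fix x and v :: R3 assume "x \<in> ?S" "v \<noteq> 0"
    then show "v \<bullet> (?G x *v v) > 0"
      using metric c unfolding riemannian_metric_def R(2)[symmetric] by blast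
  next
    fix i j k l
    show "C_on 2 (\<lambda>x. ?G x $ i $ j) ?S" by (rule C2)
    show "parity_decay R 1 \<delta> (?h i j)"
      using h_decay[of "[]" i j] by (simp add: pds_def)
    show "parity_decay R (-1) (1 + \<delta>) (pd k (\<lambda>x. ?G x $ i $ j))"
      using h_decay[of "[k]" i j] pd_h by (auto simp: pds_def add.commute elim: parity_decay_cong)
    have "parity_decay R 1 (2 + \<delta>) (pd l (pd k (?h i j)))"
      using h_decay[of "[l, k]" i j] by (simp add: pds_def add.commute)
    then show "parity_decay R 1 (2 + \<delta>) (pd l (pd k (\<lambda>x. ?G x $ i $ j)))"
      by (rule parity_decay_cong) (rule pd_cong[OF open_exterior _ pd_h])
  qed
  have Kd: "parity_decay R (-1) (1 + \<delta>) (\<lambda>x. K c x $ i $ j)" for i j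
    using parity_decay_pds[of 2 "1 + \<delta>" "\<lambda>x. K c x $ i $ j" "-1" R "[]"] K_dec K_even[of i j] CK
    by (simp add: pds_def add.assoc[symmetric])
  note gi = metric_like_decay[OF metric_like_ginv]
  have KK: "parity_decay R 1 (2 + 2 * \<delta>) (\<lambda>x. ginv ?G x $ i $ k * ginv ?G x $ j $ l * K c x $ i' $
      j' * K c x $ k' $ l')"
    for i j k l i' j' k' l'
    by (rule parity_decay_mult[OF parity_decay_mult[OF parity_decay_mult[OF gi gi refl order_refl]
        Kd refl order_refl] Kd]) auto
  have tr: "parity_decay R (-1) (1 + \<delta>) (\<lambda>x. tr_g ?G (K c) x)"
    unfolding tr_g_def by (intro parity_decay_sum parity_decay_mult[OF gi Kd]) auto
  have "parity_decay R 1 (2 + 2 * \<delta>) (\<lambda>x. (tr_g ?G (K c) x)\<^sup>2)"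
    unfolding power2_eq_square by (rule parity_decay_mult[OF tr tr]) auto
  moreover have "parity_decay R 1 (2 + 2 * \<delta>) (norm2_g ?G (K c))"
    unfolding norm2_g_def by (intro parity_decay_sum KK)
  ultimately have "parity_decay R 1 (2 + 2 * \<delta>) (\<lambda>x. norm2_g ?G (K c) x - (tr_g ?G (K c) x)\<^sup>2)"
    by (intro parity_decay_diff)
  then have "parity_decay R 1 (2 + 2 * \<delta>) (scalar_curvature ?G)"
    by (rule parity_decay_cong) (simp add: con)
  with rt_metric_axioms show ?thesis
    by (rule that)
qed

theorem theorem1:
  fixes M :: "'a topology" and A :: "'a chart set"
    and g K :: "'a tensor2" and c :: "'a chart"
  assumes "vacuum_initial_data M A g K"
    and "AF_RT M A g K c"
    and "adm_mass (g c) \<noteq> 0"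
  shows "\<forall>\<alpha>. (\<exists>L. (intrinsic_flux (g c) \<alpha> \<longlongrightarrow> L) at_top) \<and>
             (\<exists>L. (corvino_schoen_flux (g c) \<alpha> \<longlongrightarrow> L) at_top) \<and>
             intrinsic_center (g c) \<alpha> = corvino_schoen_center (g c) \<alpha>"
proof
  fix \<alpha>
  obtain R \<delta> where "rt_metric (g c) R \<delta>" "parity_decay R 1 (2 + 2 * \<delta>) (scalar_curvature (g c))"
    using AF_RT_imp_rt_metric[OF assms(1,2)] .
  then obtain L where L: "(intrinsic_flux (g c) \<alpha> \<longlongrightarrow> L) at_top"
    "(corvino_schoen_flux (g c) \<alpha> \<longlongrightarrow> L) at_top"
    by (rule rt_metric.center_fluxes_converge)
  then have "Lim at_top (intrinsic_flux (g c) \<alpha>) = L" "Lim at_top (corvino_schoen_flux (g c) \<alpha>) = L"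
    by (intro tendsto_Lim trivial_limit_at_top_linorder; simp)+
  with L show "(\<exists>L. (intrinsic_flux (g c) \<alpha> \<longlongrightarrow> L) at_top) \<and>
      (\<exists>L. (corvino_schoen_flux (g c) \<alpha> \<longlongrightarrow> L) at_top) \<and>
      intrinsic_center (g c) \<alpha> = corvino_schoen_center (g c) \<alpha>"
    by (auto simp: intrinsic_center_def corvino_schoen_center_def)
qed

end
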